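(* If $\psi$ is singular, that is $\psi(M_1)=0$, then the $\mathfrak{sv}$-module $L_{\psi,\xi}$ is reducible for any $\xi\in\mathbb{C}$.
   Context: The Schrödinger-Virasoro algebra $\mathfrak{sv}$ is the complex Lie algebra with basis $\{L_n,M_n,Y_{n+\frac12}\mid n\in\mathbb{Z}\}$ and brackets, for $m,n\in\mathbb{Z}$: $[L_m,L_n]=(n-m)L_{m+n}$, $[L_m,M_n]=nM_{m+n}$, $[L_m,Y_{n+\frac12}]=(n+\frac{1-m}{2})Y_{m+n+\frac12}$, $[Y_{m+\frac12},Y_{n+\frac12}]=(n-m)M_{m+n+1}$, $[M_m,M_n]=[M_m,Y_{n+\frac12}]=0$. The element $M_0$ is central. Put $\mathfrak{sv}^+=\mathrm{span}_{\mathbb{C}}\{L_n,M_n,Y_{m+\frac12}\mid n\geq 1,\ m\geq 0\}$. Let $\psi:\mathfrak{sv}^+\to\mathbb{C}$ be a Lie algebra homomorphism; throughout, $\psi(L_n)=0$ for $n\geq 3$, $\psi(M_m)=0$ for $m\geq 2$, and $\psi(Y_{\frac12+k})=0$ for $k\geq 1$. Let $\mathbb{C}_\psi$ be the one-dimensional $\mathfrak{sv}^+$-module with $x\alpha=\psi(x)\alpha$, let $W_\psi=U(\mathfrak{sv})\otimes_{U(\mathfrak{sv}^+)}\mathbb{C}_\psi$, and for $\xi\in\mathbb{C}$ let $L_{\psi,\xi}=W_\psi/(M_0-\xi)W_\psi$. Reducible means having a submodule that is neither zero nor the whole module. *)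

theory Defs
  imports Complex_Main "HOL-Library.Poly_Mapping"
begin

section \<open>Complex vector spaces, algebras and Lie algebras\<close>

class complex_vec = ab_group_add +
  fixes scaleC :: "complex \<Rightarrow> 'a \<Rightarrow> 'a"  (infixr "*\<^sub>C" 75)
  assumes scaleC_add_right: "c *\<^sub>C (x + y) = c *\<^sub>C x + c *\<^sub>C y"
    and scaleC_add_left: "(c + d) *\<^sub>C x = c *\<^sub>C x + d *\<^sub>C x"
    and scaleC_scaleC: "c *\<^sub>C d *\<^sub>C x = (c * d) *\<^sub>C x"
    and scaleC_one: "1 *\<^sub>C x = x"

interpretation cvec: vector_space "scaleC :: complex \<Rightarrow> 'a \<Rightarrow> 'a :: complex_vec"
  by unfold_locales (simp_all add: scaleC_add_right scaleC_add_left scaleC_scaleC scaleC_one)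

class complex_algebra = complex_vec + ring_1 +
  assumes scaleC_mult_left: "c *\<^sub>C x * y = c *\<^sub>C (x * y)"
    and scaleC_mult_right: "x * c *\<^sub>C y = c *\<^sub>C (x * y)"

class complex_lie_algebra = complex_vec +
  fixes bracket :: "'a \<Rightarrow> 'a \<Rightarrow> 'a"
  assumes bracket_add_left: "bracket (x + y) z = bracket x z + bracket y z"
    and bracket_add_right: "bracket x (y + z) = bracket x y + bracket x z"
    and bracket_scale_left: "bracket (c *\<^sub>C x) y = c *\<^sub>C bracket x y"
    and bracket_scale_right: "bracket x (c *\<^sub>C y) = c *\<^sub>C bracket x y"
    and bracket_self: "bracket x x = 0"
    and jacobi: "bracket x (bracket y z) + bracket y (bracket z x) + bracket z (bracket x y) = 0"

definition lie_hom :: "('g :: complex_lie_algebra \<Rightarrow> 'h :: complex_lie_algebra) \<Rightarrow> bool" where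
  "lie_hom f \<longleftrightarrow> (\<forall>x y. f (x + y) = f x + f y) \<and> (\<forall>c x. f (c *\<^sub>C x) = c *\<^sub>C f x) \<and>
     (\<forall>x y. f (bracket x y) = bracket (f x) (f y))"

text \<open>The complex numbers are an algebra and the one-dimensional abelian Lie algebra.\<close>

instantiation complex :: "{complex_algebra, complex_lie_algebra}"
begin

definition scaleC_complex :: "complex \<Rightarrow> complex \<Rightarrow> complex" where
  "scaleC_complex c x = c * x"

definition bracket_complex :: "complex \<Rightarrow> complex \<Rightarrow> complex" where
  "bracket_complex x y = 0"

instance
  by standard (simp_all add: scaleC_complex_def bracket_complex_def algebra_simps)

end

section \<open>Free vector spaces\<close>

instantiation poly_mapping :: (type, complex_vec) complex_vec
begin

lift_definition scaleC_poly_mapping :: "complex \<Rightarrow> ('a \<Rightarrow>\<^sub>0 'b) \<Rightarrow> 'a \<Rightarrow>\<^sub>0 'b"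
  is "\<lambda>c f k. c *\<^sub>C f k"
proof -
  fix c :: complex and f :: "'a \<Rightarrow> 'b"
  assume "finite {k. f k \<noteq> 0}"
  then show "finite {k. c *\<^sub>C f k \<noteq> 0}"
    by (rule rev_finite_subset) auto
qed

instance
  by standard (transfer, simp add: fun_eq_iff scaleC_add_right scaleC_add_left scaleC_scaleC scaleC_one)+

end

lemma lookup_scaleC [simp]: "Poly_Mapping.lookup (c *\<^sub>C p) k = c *\<^sub>C Poly_Mapping.lookup p k"
  by transfer simp

definition lin_ext :: "('b \<Rightarrow> 'v :: complex_vec) \<Rightarrow> ('b \<Rightarrow>\<^sub>0 complex) \<Rightarrow> 'v" where
  "lin_ext f p = (\<Sum>b\<in>Poly_Mapping.keys p. Poly_Mapping.lookup p b *\<^sub>C f b)"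

lemma lin_ext_superset:
  assumes "finite A" "Poly_Mapping.keys p \<subseteq> A"
  shows "lin_ext f p = (\<Sum>b\<in>A. Poly_Mapping.lookup p b *\<^sub>C f b)"
  unfolding lin_ext_def
  by (rule sum.mono_neutral_left) (use assms in \<open>auto simp: in_keys_iff\<close>)

lemma lin_ext_add: "lin_ext f (p + q) = lin_ext f p + lin_ext f q"
proof -
  let ?A = "Poly_Mapping.keys p \<union> Poly_Mapping.keys q"
  have "Poly_Mapping.keys (p + q) \<subseteq> ?A" by (rule keys_add)
  then show ?thesis
    by (simp add: lin_ext_superset[of ?A] lookup_add scaleC_add_left sum.distrib)
qed

lemma lin_ext_scale: "lin_ext f (c *\<^sub>C p) = c *\<^sub>C lin_ext f p"
proof -
  have "Poly_Mapping.keys (c *\<^sub>C p) \<subseteq> Poly_Mapping.keys p" by (auto simp: in_keys_iff)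
  then show ?thesis
    by (simp add: lin_ext_superset[of "Poly_Mapping.keys p"] scaleC_complex_def cvec.scale_sum_right scaleC_scaleC)
qed

lemma lin_ext_0 [simp]: "lin_ext f 0 = 0"
  by (simp add: lin_ext_def)

lemma lin_ext_uminus: "lin_ext f (- p) = - lin_ext f p"
  using lin_ext_add[of f p "- p"] by (simp add: eq_neg_iff_add_eq_0 add.commute)

lemma lin_ext_diff: "lin_ext f (p - q) = lin_ext f p - lin_ext f q"
  using lin_ext_add[of f p "- q"] by (simp add: lin_ext_uminus)

lemma lin_ext_single [simp]: "lin_ext f (Poly_Mapping.single b c) = c *\<^sub>C f b"
  by (simp add: lin_ext_superset[of "{b}"])

lemma lin_ext_add_fun: "lin_ext (\<lambda>b. f b + g b) p = lin_ext f p + lin_ext g p"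
  by (simp add: lin_ext_def scaleC_add_right sum.distrib)

lemma lin_ext_scale_fun: "lin_ext (\<lambda>b. c *\<^sub>C f b) p = c *\<^sub>C lin_ext f p"
  by (simp add: lin_ext_def cvec.scale_sum_right scaleC_scaleC mult.commute)

lemma single_scale: "Poly_Mapping.single b c = c *\<^sub>C Poly_Mapping.single b (1 :: complex)"
  by (rule poly_mapping_eqI) (simp add: lookup_single when_def scaleC_complex_def)

lemma lin_ext_ident: "lin_ext (\<lambda>b. Poly_Mapping.single b 1) p = p"
proof (rule poly_mapping_eqI)
  fix k
  have "Poly_Mapping.lookup (lin_ext (\<lambda>b. Poly_Mapping.single b 1) p) k
      = (\<Sum>b\<in>Poly_Mapping.keys p. Poly_Mapping.lookup p b * (1 when b = k))"
    by (simp add: lin_ext_def lookup_sum lookup_single scaleC_complex_def)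
  also have "\<dots> = (\<Sum>b\<in>Poly_Mapping.keys p. if b = k then Poly_Mapping.lookup p b else 0)"
    by (rule sum.cong) (auto simp: when_def)
  also have "\<dots> = Poly_Mapping.lookup p k"
    by (simp add: in_keys_iff)
  finally show "Poly_Mapping.lookup (lin_ext (\<lambda>b. Poly_Mapping.single b 1) p) k = Poly_Mapping.lookup p k" .
qed

lemma free_induct [case_names zero add scale single]:
  fixes p :: "'b \<Rightarrow>\<^sub>0 complex"
  assumes "P 0" "\<And>p q. P p \<Longrightarrow> P q \<Longrightarrow> P (p + q)" "\<And>c p. P p \<Longrightarrow> P (c *\<^sub>C p)"
    "\<And>b. P (Poly_Mapping.single b 1)"
  shows "P p"
proof -
  have "P (\<Sum>b\<in>A. Poly_Mapping.lookup p b *\<^sub>C Poly_Mapping.single b 1)" if "finite A" for A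
    using that by induction (use assms in auto)
  from this[of "Poly_Mapping.keys p"] show ?thesis
    by (simp flip: lin_ext_def add: lin_ext_ident)
qed

section \<open>The Schroedinger-Virasoro algebra\<close>

text \<open>The index \<open>IY n\<close> stands for the basis vector with subscript \<open>n + 1/2\<close>.\<close>

datatype sv_index = IL int | IM int | IY int

fun sv_struct :: "sv_index \<Rightarrow> sv_index \<Rightarrow> (sv_index \<Rightarrow>\<^sub>0 complex)" where
  "sv_struct (IL m) (IL n) = Poly_Mapping.single (IL (m + n)) (of_int (n - m))"
| "sv_struct (IL m) (IM n) = Poly_Mapping.single (IM (m + n)) (of_int n)"
| "sv_struct (IL m) (IY n) = Poly_Mapping.single (IY (m + n)) (of_int n + (1 - of_int m) / 2)"
| "sv_struct (IY m) (IY n) = Poly_Mapping.single (IM (m + n + 1)) (of_int (n - m))"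
| "sv_struct (IM m) (IL n) = - Poly_Mapping.single (IM (n + m)) (of_int m)"
| "sv_struct (IY m) (IL n) = - Poly_Mapping.single (IY (n + m)) (of_int m + (1 - of_int n) / 2)"
| "sv_struct (IM m) (IM n) = 0"
| "sv_struct (IM m) (IY n) = 0"
| "sv_struct (IY m) (IM n) = 0"

definition sv_bracket ::
    "(sv_index \<Rightarrow>\<^sub>0 complex) \<Rightarrow> (sv_index \<Rightarrow>\<^sub>0 complex) \<Rightarrow> (sv_index \<Rightarrow>\<^sub>0 complex)" where
  "sv_bracket x y = lin_ext (\<lambda>i. lin_ext (sv_struct i) y) x"

lemma sv_bracket_add_left: "sv_bracket (x + y) z = sv_bracket x z + sv_bracket y z"
  by (simp add: sv_bracket_def lin_ext_add)

lemma sv_bracket_add_right: "sv_bracket x (y + z) = sv_bracket x y + sv_bracket x z"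
  by (simp add: sv_bracket_def lin_ext_add lin_ext_add_fun)

lemma sv_bracket_scale_left: "sv_bracket (c *\<^sub>C x) y = c *\<^sub>C sv_bracket x y"
  by (simp add: sv_bracket_def lin_ext_scale)

lemma sv_bracket_scale_right: "sv_bracket x (c *\<^sub>C y) = c *\<^sub>C sv_bracket x y"
  by (simp add: sv_bracket_def lin_ext_scale lin_ext_scale_fun)

lemmas sv_bracket_linear =
  sv_bracket_add_left sv_bracket_add_right sv_bracket_scale_left sv_bracket_scale_right

lemma sv_bracket_0 [simp]: "sv_bracket 0 y = 0" "sv_bracket x 0 = 0"
  by (simp_all add: sv_bracket_def lin_ext_def)

lemma sv_bracket_uminus: "sv_bracket (- x) y = - sv_bracket x y" "sv_bracket x (- y) = - sv_bracket x y"
  using sv_bracket_add_left[of x "- x" y] sv_bracket_add_right[of x y "- y"]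
  by (simp_all add: eq_neg_iff_add_eq_0 add.commute)

lemma sv_bracket_single:
  "sv_bracket (Poly_Mapping.single i c) (Poly_Mapping.single j d) = (c * d) *\<^sub>C sv_struct i j"
  by (simp add: sv_bracket_def scaleC_scaleC)

lemma sv_struct_antisym: "sv_struct i j = - sv_struct j i"
  by (cases i; cases j)
    (auto simp: add.commute simp flip: single_uminus)

lemma sv_bracket_antisym: "sv_bracket x y = - sv_bracket y x"
proof (induction x rule: free_induct)
  case (single i)
  show ?case
  proof (induction y rule: free_induct)
    case (single j)
    show ?case
      using sv_struct_antisym[of i j] by (simp add: sv_bracket_single scaleC_one)
  qed (simp_all add: sv_bracket_linear)
qed (simp_all add: sv_bracket_linear)

lemma sv_bracket_self: "sv_bracket x x = 0"
proof -
  have "(2 :: complex) *\<^sub>C sv_bracket x x = 0"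
    using sv_bracket_antisym[of x x] scaleC_add_left[of 1 1 "sv_bracket x x"]
    by (simp add: scaleC_one eq_neg_iff_add_eq_0)
  then show ?thesis by simp
qed

lemma scaleC_single: "c *\<^sub>C Poly_Mapping.single b d = Poly_Mapping.single b (c * d :: complex)"
  by (rule poly_mapping_eqI) (simp add: lookup_single when_def scaleC_complex_def)

lemma sv_jacobi_single:
  fixes i j k :: sv_index
  defines "e \<equiv> \<lambda>i. Poly_Mapping.single i (1 :: complex)"
  shows "sv_bracket (e i) (sv_bracket (e j) (e k)) + sv_bracket (e j) (sv_bracket (e k) (e i))
       + sv_bracket (e k) (sv_bracket (e i) (e j)) = 0"
  unfolding e_def
  apply (cases i; cases j; cases k)
  apply (simp_all add: sv_bracket_single sv_bracket_uminus scaleC_single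
      scaleC_one scaleC_scaleC add.assoc add.commute add.left_commute
      del: of_int_diff of_int_add flip: single_add single_uminus single_diff)
  apply (simp_all add: field_simps)
  done

lemma sv_jacobi:
  "sv_bracket x (sv_bracket y z) + sv_bracket y (sv_bracket z x) + sv_bracket z (sv_bracket x y) = 0"
proof -
  define J where "J x y z = sv_bracket x (sv_bracket y z) + sv_bracket y (sv_bracket z x)
    + sv_bracket z (sv_bracket x y)" for x y z
  have add: "J (p + q) y z = J p y z + J q y z" for p q y z
    by (simp add: J_def sv_bracket_linear algebra_simps)
  have scale: "J (c *\<^sub>C p) y z = c *\<^sub>C J p y z" for c p y z
    by (simp add: J_def sv_bracket_linear scaleC_add_right)
  have zero: "J 0 y z = 0" for y z by (simp add: J_def)
  have cycle: "J x y z = J y z x" for x y z by (simp add: J_def algebra_simps)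
  have ind: "J x y z = 0" if "\<And>i. J (Poly_Mapping.single i 1) y z = 0" for x y z
    by (induction x rule: free_induct) (simp_all add: add scale zero that)
  have "J x y z = 0"
  proof (rule ind)
    fix i
    have "J y z (Poly_Mapping.single i 1) = 0"
    proof (rule ind)
      fix j
      have "J z (Poly_Mapping.single i 1) (Poly_Mapping.single j 1) = 0"
        by (rule ind) (simp only: J_def sv_jacobi_single)
      then show "J (Poly_Mapping.single j 1) z (Poly_Mapping.single i 1) = 0"
        by (simp add: cycle[of "Poly_Mapping.single j 1"])
    qed
    then show "J (Poly_Mapping.single i 1) y z = 0"
      by (simp add: cycle[of "Poly_Mapping.single i 1"])
  qed
  then show ?thesis by (simp add: J_def)
qed

typedef sv = "UNIV :: (sv_index \<Rightarrow>\<^sub>0 complex) set" ..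

setup_lifting type_definition_sv

instantiation sv :: complex_lie_algebra
begin

lift_definition zero_sv :: sv is 0 .
lift_definition plus_sv :: "sv \<Rightarrow> sv \<Rightarrow> sv" is "(+)" .
lift_definition minus_sv :: "sv \<Rightarrow> sv \<Rightarrow> sv" is "(-)" .
lift_definition uminus_sv :: "sv \<Rightarrow> sv" is uminus .
lift_definition scaleC_sv :: "complex \<Rightarrow> sv \<Rightarrow> sv" is "(*\<^sub>C)" .
lift_definition bracket_sv :: "sv \<Rightarrow> sv \<Rightarrow> sv" is sv_bracket .

instance
  by standard
    (simp_all add: Rep_sv_inject [symmetric] zero_sv.rep_eq plus_sv.rep_eq minus_sv.rep_eq
      uminus_sv.rep_eq scaleC_sv.rep_eq bracket_sv.rep_eq
      scaleC_add_right scaleC_add_left scaleC_scaleC scaleC_one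
      sv_bracket_linear sv_bracket_self sv_jacobi[unfolded add.assoc] add.assoc add.commute add.left_commute)

end

lift_definition svL :: "int \<Rightarrow> sv" is "\<lambda>n. Poly_Mapping.single (IL n) 1" .
lift_definition svM :: "int \<Rightarrow> sv" is "\<lambda>n. Poly_Mapping.single (IM n) 1" .
lift_definition svY :: "int \<Rightarrow> sv" is "\<lambda>n. Poly_Mapping.single (IY n) 1" .

lemma sv_brackets:
  "bracket (svL m) (svL n) = of_int (n - m) *\<^sub>C svL (m + n)"
  "bracket (svL m) (svM n) = of_int n *\<^sub>C svM (m + n)"
  "bracket (svL m) (svY n) = (of_int n + (1 - of_int m) / 2) *\<^sub>C svY (m + n)"
  "bracket (svY m) (svY n) = of_int (n - m) *\<^sub>C svM (m + n + 1)"
  "bracket (svM m) (svM n) = 0"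
  "bracket (svM m) (svY n) = 0"
  by (transfer, simp add: sv_bracket_single scaleC_single)+

lemma bracket_antisym: "bracket x y = - bracket y (x :: 'a :: complex_lie_algebra)"
  using bracket_self[of "x + y"]
  by (simp only: bracket_add_left bracket_add_right bracket_self[of x] bracket_self[of y])
    (simp add: eq_neg_iff_add_eq_0 add.commute)

lemma bracket_0 [simp]: "bracket 0 (x :: 'a :: complex_lie_algebra) = 0" "bracket x 0 = 0"
  using bracket_scale_left[of 0 0 x] bracket_scale_right[of x 0 0] by simp_all

definition sv_plus_basis :: "sv set" where
  "sv_plus_basis = {svL n | n. n \<ge> 1} \<union> {svM n | n. n \<ge> 1} \<union> {svY m | m. m \<ge> 0}"

lemma bracket_sv_plus_basis:
  assumes "x \<in> sv_plus_basis" "y \<in> sv_plus_basis"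
  shows "bracket x y \<in> cvec.span sv_plus_basis"
proof -
  have L: "svL n \<in> cvec.span sv_plus_basis" "svM n \<in> cvec.span sv_plus_basis" if "n \<ge> 1" for n
    using that by (auto intro!: cvec.span_base simp: sv_plus_basis_def)
  have Y: "svY n \<in> cvec.span sv_plus_basis" if "n \<ge> 0" for n
    using that by (auto intro!: cvec.span_base simp: sv_plus_basis_def)
  have cases: "(\<exists>n\<ge>1. x = svL n) \<or> (\<exists>n\<ge>1. x = svM n) \<or> (\<exists>n\<ge>0. x = svY n)"
    if "x \<in> sv_plus_basis" for x
    using that by (auto simp: sv_plus_basis_def)
  show ?thesis
    using cases[OF assms(1)] cases[OF assms(2)]
    by (auto simp: sv_brackets bracket_antisym[of "svM _" "svL _"] bracket_antisym[of "svY _" "svL _"]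
        bracket_antisym[of "svY _" "svM _"]
        intro!: cvec.span_scale cvec.span_neg cvec.span_zero L Y)
qed

typedef sv_plus = "cvec.span sv_plus_basis"
  using cvec.span_zero by blast

setup_lifting type_definition_sv_plus

lemma bracket_sv_plus:
  assumes "x \<in> cvec.span sv_plus_basis" "y \<in> cvec.span sv_plus_basis"
  shows "bracket x y \<in> cvec.span sv_plus_basis"
proof -
  have *: "bracket x y \<in> cvec.span sv_plus_basis" if "x \<in> sv_plus_basis" for x
    using assms(2)
  proof (induction rule: cvec.span_induct_alt)
    case base
    then show ?case by (simp add: cvec.span_zero)
  next
    case (step c u v)
    then show ?case
      using bracket_sv_plus_basis[OF that step(1)]
      by (simp add: bracket_add_right bracket_scale_right cvec.span_add cvec.span_scale)
  qed
  show ?thesis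
    using assms(1)
  proof (induction rule: cvec.span_induct_alt)
    case base
    then show ?case by (simp add: cvec.span_zero)
  next
    case (step c u v)
    then show ?case
      using *[OF step(1)]
      by (simp add: bracket_add_left bracket_scale_left cvec.span_add cvec.span_scale)
  qed
qed

instantiation sv_plus :: complex_lie_algebra
begin

lift_definition zero_sv_plus :: sv_plus is 0 by (rule cvec.span_zero)
lift_definition plus_sv_plus :: "sv_plus \<Rightarrow> sv_plus \<Rightarrow> sv_plus" is "(+)" by (rule cvec.span_add)
lift_definition minus_sv_plus :: "sv_plus \<Rightarrow> sv_plus \<Rightarrow> sv_plus" is "(-)" by (rule cvec.span_diff)
lift_definition uminus_sv_plus :: "sv_plus \<Rightarrow> sv_plus" is uminus by (rule cvec.span_neg)
lift_definition scaleC_sv_plus :: "complex \<Rightarrow> sv_plus \<Rightarrow> sv_plus" is "(*\<^sub>C)" by (rule cvec.span_scale)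
lift_definition bracket_sv_plus :: "sv_plus \<Rightarrow> sv_plus \<Rightarrow> sv_plus" is bracket by (rule bracket_sv_plus)

instance
  by standard
    (simp_all add: Rep_sv_plus_inject [symmetric] zero_sv_plus.rep_eq plus_sv_plus.rep_eq
      minus_sv_plus.rep_eq uminus_sv_plus.rep_eq scaleC_sv_plus.rep_eq bracket_sv_plus.rep_eq
      scaleC_add_right scaleC_add_left scaleC_scaleC scaleC_one
      bracket_add_left bracket_add_right bracket_scale_left bracket_scale_right
      bracket_self jacobi[unfolded add.assoc] add.assoc add.commute add.left_commute)

end

lemma lie_hom_Rep_sv_plus: "lie_hom Rep_sv_plus"
  by (simp add: lie_hom_def plus_sv_plus.rep_eq scaleC_sv_plus.rep_eq bracket_sv_plus.rep_eq)

section \<open>The universal enveloping algebra\<close>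

datatype 'a word = Word (letters: "'a list")

instantiation word :: (type) monoid_add
begin

definition zero_word :: "'a word" where "0 = Word []"
definition plus_word :: "'a word \<Rightarrow> 'a word \<Rightarrow> 'a word" where "v + w = Word (letters v @ letters w)"

instance
  by standard (simp_all add: zero_word_def plus_word_def)

end

text \<open>
  With its convolution product, \<open>'g word \<Rightarrow>\<^sub>0 complex\<close> is the free associative algebra on the set \<open>'g\<close>.
\<close>

lemma sum_singles: "(\<Sum>k\<in>Poly_Mapping.keys p. Poly_Mapping.single k (Poly_Mapping.lookup p k)) = (p :: 'b \<Rightarrow>\<^sub>0 complex)"
proof -
  have "Poly_Mapping.lookup p k *\<^sub>C Poly_Mapping.single k (1 :: complex)
      = Poly_Mapping.single k (Poly_Mapping.lookup p k)" for k
    by (rule single_scale [symmetric])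
  with lin_ext_ident[of p] show ?thesis by (simp add: lin_ext_def)
qed

lemma free_mult_scale:
  fixes p :: "'k :: monoid_add \<Rightarrow>\<^sub>0 complex"
  shows "c *\<^sub>C p = Poly_Mapping.single 0 c * p" and "c *\<^sub>C p = p * Poly_Mapping.single 0 c"
proof -
  have "c *\<^sub>C (\<Sum>k\<in>Poly_Mapping.keys p. Poly_Mapping.single k (Poly_Mapping.lookup p k))
     = Poly_Mapping.single 0 c * (\<Sum>k\<in>Poly_Mapping.keys p. Poly_Mapping.single k (Poly_Mapping.lookup p k))"
    by (simp add: cvec.scale_sum_right sum_distrib_left mult_single scaleC_single)
  then show "c *\<^sub>C p = Poly_Mapping.single 0 c * p" by (simp only: sum_singles)
  have "c *\<^sub>C (\<Sum>k\<in>Poly_Mapping.keys p. Poly_Mapping.single k (Poly_Mapping.lookup p k))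
     = (\<Sum>k\<in>Poly_Mapping.keys p. Poly_Mapping.single k (Poly_Mapping.lookup p k)) * Poly_Mapping.single 0 c"
    by (simp add: cvec.scale_sum_right sum_distrib_right mult_single scaleC_single mult.commute)
  then show "c *\<^sub>C p = p * Poly_Mapping.single 0 c" by (simp only: sum_singles)
qed

lemma free_scale_mult:
  fixes p q :: "'k :: monoid_add \<Rightarrow>\<^sub>0 complex"
  shows "c *\<^sub>C p * q = c *\<^sub>C (p * q)" and "p * c *\<^sub>C q = c *\<^sub>C (p * q)"
  by (simp only: free_mult_scale(1) mult.assoc) (simp only: free_mult_scale(2) mult.assoc)

definition letter :: "'g \<Rightarrow> ('g word \<Rightarrow>\<^sub>0 complex)" where
  "letter x = Poly_Mapping.single (Word [x]) 1"

text \<open>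
  The linearity relations \<open>add\<close> and \<open>scale\<close> turn the free algebra on the set \<open>'g\<close> into the tensor
  algebra of the vector space \<open>'g\<close>. Scalar multiples need no rule of their own: they are products
  with multiples of \<open>1\<close>.
\<close>

inductive_set uea_ideal :: "('g :: complex_lie_algebra word \<Rightarrow>\<^sub>0 complex) set" where
  add: "letter (x + y) - letter x - letter y \<in> uea_ideal"
| scale: "letter (c *\<^sub>C x) - c *\<^sub>C letter x \<in> uea_ideal"
| bracket: "letter x * letter y - letter y * letter x - letter (bracket x y) \<in> uea_ideal"
| zero: "0 \<in> uea_ideal"
| plus: "p \<in> uea_ideal \<Longrightarrow> q \<in> uea_ideal \<Longrightarrow> p + q \<in> uea_ideal"
| mult: "p \<in> uea_ideal \<Longrightarrow> a * p * b \<in> uea_ideal"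

lemma uea_ideal_left: "p \<in> uea_ideal \<Longrightarrow> a * p \<in> uea_ideal"
  using uea_ideal.mult[of p a 1] by simp

lemma uea_ideal_right: "p \<in> uea_ideal \<Longrightarrow> p * b \<in> uea_ideal"
  using uea_ideal.mult[of p 1 b] by simp

lemma uea_ideal_uminus: "p \<in> uea_ideal \<Longrightarrow> - p \<in> uea_ideal"
  using uea_ideal_left[of p "- 1"] by simp

lemma uea_ideal_scale: "p \<in> uea_ideal \<Longrightarrow> c *\<^sub>C p \<in> uea_ideal"
  by (simp add: free_mult_scale(1) uea_ideal_left)

definition uea_rel ::
    "('g :: complex_lie_algebra word \<Rightarrow>\<^sub>0 complex) \<Rightarrow> ('g word \<Rightarrow>\<^sub>0 complex) \<Rightarrow> bool" where
  "uea_rel p q \<longleftrightarrow> p - q \<in> uea_ideal"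

lemma uea_rel_add: "uea_rel p p' \<Longrightarrow> uea_rel q q' \<Longrightarrow> uea_rel (p + q) (p' + q')"
  unfolding uea_rel_def using uea_ideal.plus[of "p - p'" "q - q'"] by (simp add: algebra_simps)

lemma uea_rel_uminus: "uea_rel p p' \<Longrightarrow> uea_rel (- p) (- p')"
  unfolding uea_rel_def using uea_ideal_uminus[of "p - p'"] by simp

lemma uea_rel_mult: "uea_rel p p' \<Longrightarrow> uea_rel q q' \<Longrightarrow> uea_rel (p * q) (p' * q')"
  unfolding uea_rel_def
  using uea_ideal.plus[OF uea_ideal_right[of "p - p'" q] uea_ideal_left[of "q - q'" p']]
  by (simp add: algebra_simps)

lemma uea_rel_scale: "uea_rel p q \<Longrightarrow> uea_rel (c *\<^sub>C p) (c *\<^sub>C q)"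
  unfolding uea_rel_def using uea_ideal_scale[of "p - q" c]
  by (simp add: cvec.scale_right_diff_distrib)

lemma uea_rel_refl: "uea_rel p p"
  by (simp add: uea_rel_def uea_ideal.zero)

lemma uea_rel_sym: "uea_rel p q \<Longrightarrow> uea_rel q p"
  unfolding uea_rel_def using uea_ideal_uminus[of "p - q"] by simp

lemma uea_rel_trans: "uea_rel p q \<Longrightarrow> uea_rel q r \<Longrightarrow> uea_rel p r"
  unfolding uea_rel_def using uea_ideal.plus[of "p - q" "q - r"] by simp

quotient_type (overloaded) 'g uea = "'g :: complex_lie_algebra word \<Rightarrow>\<^sub>0 complex" / uea_rel
  by (auto intro!: equivpI reflpI sympI transpI intro: uea_rel_refl uea_rel_sym uea_rel_trans)

text \<open>Extension of a map on \<open>'g\<close> to words, multiplicatively, and then linearly to the free algebra.\<close>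

definition free_lift :: "('g \<Rightarrow> 'a :: complex_algebra) \<Rightarrow> ('g word \<Rightarrow>\<^sub>0 complex) \<Rightarrow> 'a" where
  "free_lift f = lin_ext (\<lambda>w. prod_list (map f (letters w)))"

lemma free_lift_linear:
  "free_lift f (p + q) = free_lift f p + free_lift f q"
  "free_lift f (p - q) = free_lift f p - free_lift f q"
  "free_lift f (c *\<^sub>C p) = c *\<^sub>C free_lift f p"
  "free_lift f 0 = 0"
  by (simp_all add: free_lift_def lin_ext_add lin_ext_diff lin_ext_scale)

lemma free_lift_letter [simp]: "free_lift f (letter x) = f x"
  by (simp add: free_lift_def letter_def scaleC_one)

lemma free_lift_1 [simp]: "free_lift f 1 = 1"
  by (simp add: free_lift_def scaleC_one zero_word_def flip: single_one)

lemma free_lift_mult: "free_lift f (p * q) = free_lift f p * free_lift f q"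
proof (induction p rule: free_induct)
  case (single v)
  show ?case
  proof (induction q rule: free_induct)
    case (single w)
    show ?case
      by (simp add: mult_single) (simp add: free_lift_def plus_word_def scaleC_one)
  qed (simp_all add: free_lift_linear free_scale_mult scaleC_mult_right distrib_left)
qed (simp_all add: free_lift_linear free_scale_mult scaleC_mult_left distrib_right)

text \<open>Lie algebra homomorphisms into an associative algebra with its commutator bracket.\<close>

definition lie_rep :: "('g :: complex_lie_algebra \<Rightarrow> 'a :: complex_algebra) \<Rightarrow> bool" where
  "lie_rep f \<longleftrightarrow> (\<forall>x y. f (x + y) = f x + f y) \<and> (\<forall>c x. f (c *\<^sub>C x) = c *\<^sub>C f x) \<and>
     (\<forall>x y. f (bracket x y) = f x * f y - f y * f x)"

lemma free_lift_ideal: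
  assumes "lie_rep f" "p \<in> uea_ideal"
  shows "free_lift f p = 0"
  using assms(2)
  by induction (use assms(1) in \<open>simp_all add: lie_rep_def free_lift_linear free_lift_mult\<close>)

lemma uea_rel_free_lift:
  assumes "lie_rep f" "uea_rel p q"
  shows "free_lift f p = free_lift f q"
  using free_lift_ideal[OF assms(1), of "p - q"] assms(2)
  by (simp add: uea_rel_def free_lift_linear)

lemma not_uea_rel_0_1: "\<not> uea_rel 0 1"
proof
  assume "uea_rel (0 :: 'a word \<Rightarrow>\<^sub>0 complex) 1"
  moreover have "lie_rep (\<lambda>x :: 'a. 0 :: complex)" by (simp add: lie_rep_def)
  ultimately show False using uea_rel_free_lift by (fastforce simp: free_lift_linear)
qed

instantiation uea :: (complex_lie_algebra) complex_algebra
begin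

lift_definition zero_uea :: "'a uea" is 0 .
lift_definition one_uea :: "'a uea" is 1 .
lift_definition plus_uea :: "'a uea \<Rightarrow> 'a uea \<Rightarrow> 'a uea" is "(+)" by (rule uea_rel_add)
lift_definition uminus_uea :: "'a uea \<Rightarrow> 'a uea" is uminus by (rule uea_rel_uminus)
lift_definition minus_uea :: "'a uea \<Rightarrow> 'a uea \<Rightarrow> 'a uea" is "(-)"
  using uea_rel_add uea_rel_uminus by (metis add_uminus_conv_diff)
lift_definition times_uea :: "'a uea \<Rightarrow> 'a uea \<Rightarrow> 'a uea" is "(*)" by (rule uea_rel_mult)
lift_definition scaleC_uea :: "complex \<Rightarrow> 'a uea \<Rightarrow> 'a uea" is "(*\<^sub>C)" by (rule uea_rel_scale)

instance
proof
  fix a b c :: "'a uea" and r s :: complex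
  show "a + b + c = a + (b + c)"
    by transfer (simp add: uea_rel_refl add.assoc)
  show "a + b = b + a"
    by transfer (simp add: uea_rel_refl add.commute)
  show "0 + a = a" "- a + a = 0" "a - b = a + - b" "1 * a = a" "a * 1 = a"
    by (transfer, simp add: uea_rel_refl)+
  show "(0 :: 'a uea) \<noteq> 1"
    by transfer (rule not_uea_rel_0_1)
  show "a * b * c = a * (b * c)"
    by transfer (simp add: uea_rel_refl mult.assoc)
  show "(a + b) * c = a * c + b * c" "a * (b + c) = a * b + a * c"
    by (transfer, simp add: uea_rel_refl distrib_left distrib_right)+
  show "r *\<^sub>C (a + b) = r *\<^sub>C a + r *\<^sub>C b" "(r + s) *\<^sub>C a = r *\<^sub>C a + s *\<^sub>C a"
    "r *\<^sub>C s *\<^sub>C a = (r * s) *\<^sub>C a" "1 *\<^sub>C a = a"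
    by (transfer, simp add: uea_rel_refl scaleC_add_right scaleC_add_left scaleC_scaleC scaleC_one)+
  show "r *\<^sub>C a * b = r *\<^sub>C (a * b)" "a * r *\<^sub>C b = r *\<^sub>C (a * b)"
    by (transfer, simp add: uea_rel_refl free_scale_mult)+
qed

end

lift_definition uea_incl :: "'g :: complex_lie_algebra \<Rightarrow> 'g uea" is letter .

lemma lie_hom_imp_lie_rep: "lie_hom \<psi> \<Longrightarrow> lie_rep \<psi>" for \<psi> :: "'g :: complex_lie_algebra \<Rightarrow> complex"
  by (simp add: lie_hom_def lie_rep_def bracket_complex_def)

lemma lie_rep_uea_incl: "lie_rep (uea_incl :: 'g :: complex_lie_algebra \<Rightarrow> 'g uea)"
  unfolding lie_rep_def
proof (intro conjI allI)
  fix x y :: 'g and c :: complex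
  show "uea_incl (x + y) = uea_incl x + uea_incl y"
    using uea_ideal.add[of x y] by transfer (simp add: uea_rel_def algebra_simps)
  show "uea_incl (c *\<^sub>C x) = c *\<^sub>C uea_incl x"
    using uea_ideal.scale[of c x] by transfer (simp add: uea_rel_def)
  show "uea_incl (bracket x y) = uea_incl x * uea_incl y - uea_incl y * uea_incl x"
    using uea_ideal_uminus[OF uea_ideal.bracket[of x y]] by transfer (simp add: uea_rel_def)
qed

lemma uea_incl_simps:
  "uea_incl (x + y) = uea_incl x + uea_incl y"
  "uea_incl (c *\<^sub>C x) = c *\<^sub>C uea_incl x"
  "uea_incl (bracket x y) = uea_incl x * uea_incl y - uea_incl y * uea_incl x"
  by (simp_all add: lie_rep_uea_incl [unfolded lie_rep_def])

text \<open>
  The algebra homomorphism \<open>'g uea \<Rightarrow> 'a\<close> extending \<open>f\<close>. It does not depend on the chosen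
  representative when \<open>lie_rep f\<close>, see \<open>uea_lift\<close> below; otherwise it is meaningless.
\<close>

definition uea_lift :: "('g :: complex_lie_algebra \<Rightarrow> 'a :: complex_algebra) \<Rightarrow> 'g uea \<Rightarrow> 'a" where
  "uea_lift f u = free_lift f (rep_uea u)"

lemma uea_lift_abs: "lie_rep f \<Longrightarrow> uea_lift f (abs_uea p) = free_lift f p"
  unfolding uea_lift_def
  by (rule uea_rel_free_lift) (auto intro: rep_abs_rsp_left Quotient3_uea simp: uea_rel_refl rep_abs_rsp_left[OF Quotient3_uea])

lemma uea_lift:
  assumes "lie_rep f"
  shows "uea_lift f (uea_incl x) = f x" "uea_lift f 1 = 1" "uea_lift f (u * v) = uea_lift f u * uea_lift f v"
    "uea_lift f (u + v) = uea_lift f u + uea_lift f v" "uea_lift f (c *\<^sub>C u) = c *\<^sub>C uea_lift f u"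
proof -
  obtain p q where [simp]: "u = abs_uea p" "v = abs_uea q"
    by (metis Quotient3_abs_rep[OF Quotient3_uea])
  note [simp] = uea_lift_abs[OF assms]
  show "uea_lift f (uea_incl x) = f x" by (simp add: uea_incl.abs_eq)
  show "uea_lift f 1 = 1" by (simp add: one_uea.abs_eq)
  show "uea_lift f (u * v) = uea_lift f u * uea_lift f v" by (simp add: times_uea.abs_eq free_lift_mult)
  show "uea_lift f (u + v) = uea_lift f u + uea_lift f v" by (simp add: plus_uea.abs_eq free_lift_linear)
  show "uea_lift f (c *\<^sub>C u) = c *\<^sub>C uea_lift f u" by (simp add: scaleC_uea.abs_eq free_lift_linear)
qed

section \<open>Modules with explicit carrier\<close>

text \<open>
  Only the operations: the module axioms are the predicate \<open>lie_module\<close>. Explicit carriers are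
  needed because the modules below depend on parameters.
\<close>

record ('g, 'v) lie_mod =
  carrier :: "'v set"
  vzero :: 'v
  vadd :: "'v \<Rightarrow> 'v \<Rightarrow> 'v"
  vscale :: "complex \<Rightarrow> 'v \<Rightarrow> 'v"
  act :: "'g \<Rightarrow> 'v \<Rightarrow> 'v"

locale action_space =
  fixes V :: "('g :: complex_lie_algebra, 'v) lie_mod"
  assumes zero_closed: "vzero V \<in> carrier V"
    and add_closed: "v \<in> carrier V \<Longrightarrow> w \<in> carrier V \<Longrightarrow> vadd V v w \<in> carrier V"
    and scale_closed: "v \<in> carrier V \<Longrightarrow> vscale V c v \<in> carrier V"
    and act_closed: "v \<in> carrier V \<Longrightarrow> act V x v \<in> carrier V"
    and add_assoc: "u \<in> carrier V \<Longrightarrow> v \<in> carrier V \<Longrightarrow> w \<in> carrier V \<Longrightarrow>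
      vadd V (vadd V u v) w = vadd V u (vadd V v w)"
    and add_commute: "v \<in> carrier V \<Longrightarrow> w \<in> carrier V \<Longrightarrow> vadd V v w = vadd V w v"
    and add_zero: "v \<in> carrier V \<Longrightarrow> vadd V (vzero V) v = v"
    and add_inverse: "v \<in> carrier V \<Longrightarrow> vadd V v (vscale V (- 1) v) = vzero V"
    and scale_add_right: "v \<in> carrier V \<Longrightarrow> w \<in> carrier V \<Longrightarrow>
      vscale V c (vadd V v w) = vadd V (vscale V c v) (vscale V c w)"
    and scale_add_left: "v \<in> carrier V \<Longrightarrow>
      vscale V (c + d) v = vadd V (vscale V c v) (vscale V d v)"
    and scale_scale: "v \<in> carrier V \<Longrightarrow> vscale V c (vscale V d v) = vscale V (c * d) v"
    and scale_one: "v \<in> carrier V \<Longrightarrow> vscale V 1 v = v"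
    and act_add: "v \<in> carrier V \<Longrightarrow> w \<in> carrier V \<Longrightarrow>
      act V x (vadd V v w) = vadd V (act V x v) (act V x w)"
    and act_scale: "v \<in> carrier V \<Longrightarrow> act V x (vscale V c v) = vscale V c (act V x v)"

locale lie_module = action_space +
  assumes add_act: "v \<in> carrier V \<Longrightarrow> act V (x + y) v = vadd V (act V x v) (act V y v)"
    and scale_act: "v \<in> carrier V \<Longrightarrow> act V (c *\<^sub>C x) v = vscale V c (act V x v)"
    and bracket_act: "v \<in> carrier V \<Longrightarrow>
      act V (bracket x y) v = vadd V (act V x (act V y v)) (vscale V (- 1) (act V y (act V x v)))"

definition submodule :: "'v set \<Rightarrow> ('g, 'v) lie_mod \<Rightarrow> bool" where
  "submodule N V \<longleftrightarrow> N \<subseteq> carrier V \<and> vzero V \<in> N \<and> (\<forall>v\<in>N. \<forall>w\<in>N. vadd V v w \<in> N) \<and>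
     (\<forall>c. \<forall>v\<in>N. vscale V c v \<in> N) \<and> (\<forall>x. \<forall>v\<in>N. act V x v \<in> N)"

definition reducible :: "('g, 'v) lie_mod \<Rightarrow> bool" where
  "reducible V \<longleftrightarrow> (\<exists>N. submodule N V \<and> N \<noteq> {vzero V} \<and> N \<noteq> carrier V)"

definition coset :: "('g, 'v) lie_mod \<Rightarrow> 'v set \<Rightarrow> 'v \<Rightarrow> 'v set" where
  "coset V N v = {vadd V v n | n. n \<in> N}"

text \<open>
  In \<open>vscale\<close> and \<open>act\<close> a coset is added back, since the image of a coset of \<open>N\<close> under a linear
  map that preserves \<open>N\<close> can be smaller than a coset (scaling by \<open>0\<close>, for instance).
\<close>

definition quotient_mod :: "('g, 'v) lie_mod \<Rightarrow> 'v set \<Rightarrow> ('g, 'v set) lie_mod" where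
  "quotient_mod V N =
    \<lparr>carrier = {coset V N v | v. v \<in> carrier V},
     vzero = N,
     vadd = \<lambda>A B. {vadd V a b | a b. a \<in> A \<and> b \<in> B},
     vscale = \<lambda>c A. {vadd V (vscale V c a) n | a n. a \<in> A \<and> n \<in> N},
     act = \<lambda>x A. {vadd V (act V x a) n | a n. a \<in> A \<and> n \<in> N}\<rparr>"

context action_space
begin

lemma add_left_commute: "u \<in> carrier V \<Longrightarrow> v \<in> carrier V \<Longrightarrow> w \<in> carrier V \<Longrightarrow>
    vadd V u (vadd V v w) = vadd V v (vadd V u w)"
  by (metis add_assoc add_commute)

lemmas closed = zero_closed add_closed scale_closed act_closed

lemma add_zero_right: "v \<in> carrier V \<Longrightarrow> vadd V v (vzero V) = v"
  by (metis add_commute add_zero zero_closed)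

lemma cancel_inverse: "v \<in> carrier V \<Longrightarrow> w \<in> carrier V \<Longrightarrow>
    vadd V v (vadd V w (vscale V (- 1) w)) = v"
  by (simp add: add_inverse add_zero_right)

context
  fixes N
  assumes N: "submodule N V"
begin

lemma sub_carrier: "n \<in> N \<Longrightarrow> n \<in> carrier V"
  using N by (auto simp: submodule_def)

lemma sub_closed:
  "vzero V \<in> N" "v \<in> N \<Longrightarrow> w \<in> N \<Longrightarrow> vadd V v w \<in> N" "v \<in> N \<Longrightarrow> vscale V c v \<in> N"
  "v \<in> N \<Longrightarrow> act V x v \<in> N"
  using N by (auto simp: submodule_def)

lemma coset_eqI:
  assumes "v \<in> carrier V" "w \<in> carrier V" "n \<in> N" "v = vadd V w n"
  shows "coset V N v = coset V N w"
proof
  show "coset V N v \<subseteq> coset V N w"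
    unfolding coset_def using assms by (force simp: add_assoc sub_carrier intro: sub_closed)
  have "vadd V w m = vadd V v (vadd V m (vscale V (- 1) n))" if "m \<in> N" for m
  proof -
    have "vadd V v (vadd V m (vscale V (- 1) n)) = vadd V w (vadd V m (vadd V n (vscale V (- 1) n)))"
      using assms that by (simp add: add_assoc add_left_commute closed sub_carrier)
    then show ?thesis using assms that by (simp add: cancel_inverse sub_carrier)
  qed
  then show "coset V N w \<subseteq> coset V N v"
    unfolding coset_def using assms(3) by (blast intro: sub_closed)
qed

lemma cosetI: "n \<in> N \<Longrightarrow> w = vadd V v n \<Longrightarrow> w \<in> coset V N v"
  by (auto simp: coset_def)

lemma coset_mem: "n \<in> N \<Longrightarrow> vadd V v n \<in> coset V N v"
  by (rule cosetI) simp_all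

lemma cosetE:
  assumes "w \<in> coset V N v"
  obtains n where "n \<in> N" "w = vadd V v n"
  using assms by (auto simp: coset_def)

lemma coset_self: "v \<in> carrier V \<Longrightarrow> v \<in> coset V N v"
  by (rule cosetI[of "vzero V"]) (simp_all add: sub_closed add_zero_right)

lemma quotient_zero: "vzero (quotient_mod V N) = coset V N (vzero V)"
  by (auto simp: quotient_mod_def coset_def add_zero sub_carrier) (metis add_zero sub_carrier)

lemma quotient_add:
  assumes "v \<in> carrier V" "w \<in> carrier V"
  shows "vadd (quotient_mod V N) (coset V N v) (coset V N w) = coset V N (vadd V v w)"
proof -
  have *: "vadd V (vadd V v m) (vadd V w n) = vadd V (vadd V v w) (vadd V m n)"
    if "m \<in> N" "n \<in> N" for m n
    using assms that by (simp add: add_assoc add_left_commute closed sub_carrier)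
  show ?thesis
  proof (intro set_eqI iffI)
    fix z
    assume "z \<in> vadd (quotient_mod V N) (coset V N v) (coset V N w)"
    then obtain m n where "m \<in> N" "n \<in> N" "z = vadd V (vadd V v m) (vadd V w n)"
      by (auto simp: quotient_mod_def elim!: cosetE)
    then show "z \<in> coset V N (vadd V v w)"
      using * by (simp add: coset_mem sub_closed)
  next
    fix z
    assume "z \<in> coset V N (vadd V v w)"
    then obtain n where "n \<in> N" "z = vadd V (vadd V v w) n"
      by (auto elim: cosetE)
    then show "z \<in> vadd (quotient_mod V N) (coset V N v) (coset V N w)"
      using assms coset_self[of v] cosetI[of n "vadd V w n" w]
      by (auto simp: quotient_mod_def add_assoc sub_carrier)
  qed
qed

lemma quotient_scale:
  assumes "v \<in> carrier V"
  shows "vscale (quotient_mod V N) c (coset V N v) = coset V N (vscale V c v)"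
proof -
  have *: "vadd V (vscale V c (vadd V v m)) n = vadd V (vscale V c v) (vadd V (vscale V c m) n)"
    if "m \<in> N" "n \<in> N" for m n
    using assms that by (simp add: add_assoc scale_add_right closed sub_carrier)
  show ?thesis
  proof (intro set_eqI iffI)
    fix z
    assume "z \<in> vscale (quotient_mod V N) c (coset V N v)"
    then obtain m n where "m \<in> N" "n \<in> N" "z = vadd V (vscale V c (vadd V v m)) n"
      by (auto simp: quotient_mod_def elim!: cosetE)
    then show "z \<in> coset V N (vscale V c v)"
      using * by (simp add: coset_mem sub_closed)
  next
    fix z
    assume "z \<in> coset V N (vscale V c v)"
    then obtain n where "n \<in> N" "z = vadd V (vscale V c v) n"
      by (auto elim: cosetE)
    then show "z \<in> vscale (quotient_mod V N) c (coset V N v)"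
      using assms coset_self[of v] by (auto simp: quotient_mod_def)
  qed
qed

lemma quotient_act:
  assumes "v \<in> carrier V"
  shows "act (quotient_mod V N) x (coset V N v) = coset V N (act V x v)"
proof -
  have *: "vadd V (act V x (vadd V v m)) n = vadd V (act V x v) (vadd V (act V x m) n)"
    if "m \<in> N" "n \<in> N" for m n
    using assms that by (simp add: add_assoc act_add closed sub_carrier)
  show ?thesis
  proof (intro set_eqI iffI)
    fix z
    assume "z \<in> act (quotient_mod V N) x (coset V N v)"
    then obtain m n where "m \<in> N" "n \<in> N" "z = vadd V (act V x (vadd V v m)) n"
      by (auto simp: quotient_mod_def elim!: cosetE)
    then show "z \<in> coset V N (act V x v)"
      using * by (simp add: coset_mem sub_closed)
  next
    fix z
    assume "z \<in> coset V N (act V x v)"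
    then obtain n where "n \<in> N" "z = vadd V (act V x v) n"
      by (auto elim: cosetE)
    then show "z \<in> act (quotient_mod V N) x (coset V N v)"
      using assms coset_self[of v] by (auto simp: quotient_mod_def)
  qed
qed

lemma quotient_carrier: "A \<in> carrier (quotient_mod V N) \<longleftrightarrow> (\<exists>v\<in>carrier V. A = coset V N v)"
  by (auto simp: quotient_mod_def)

lemmas quotient_simps = quotient_zero quotient_add quotient_scale quotient_act

lemma coset_in_quotient: "v \<in> carrier V \<Longrightarrow> coset V N v \<in> carrier (quotient_mod V N)"
  by (auto simp: quotient_carrier)

lemma in_quotientE:
  assumes "A \<in> carrier (quotient_mod V N)"
  obtains v where "v \<in> carrier V" "A = coset V N v"
  using assms by (auto simp: quotient_carrier)

lemma action_space_quotient: "action_space (quotient_mod V N)"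
  by unfold_locales
    (auto elim!: in_quotientE simp: coset_in_quotient quotient_simps closed add_assoc add_zero
      add_inverse add_commute add_left_commute add_zero_right scale_add_right scale_add_left scale_scale scale_one act_add act_scale)

lemma lie_module_quotient':
  assumes "\<And>x y v. v \<in> carrier V \<Longrightarrow> \<exists>n\<in>N. act V (x + y) v = vadd V (vadd V (act V x v) (act V y v)) n"
    and "\<And>c x v. v \<in> carrier V \<Longrightarrow> \<exists>n\<in>N. act V (c *\<^sub>C x) v = vadd V (vscale V c (act V x v)) n"
    and "\<And>x y v. v \<in> carrier V \<Longrightarrow> \<exists>n\<in>N. act V (bracket x y) v =
      vadd V (vadd V (act V x (act V y v)) (vscale V (- 1) (act V y (act V x v)))) n"
  shows "lie_module (quotient_mod V N)"
proof -
  interpret Q: action_space "quotient_mod V N" by (rule action_space_quotient)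
  show ?thesis
  proof unfold_locales
    fix A x y and c :: complex
    assume "A \<in> carrier (quotient_mod V N)"
    then obtain v where v: "v \<in> carrier V" and [simp]: "A = coset V N v"
      by (auto simp: quotient_carrier)
    show "act (quotient_mod V N) (x + y) A =
        vadd (quotient_mod V N) (act (quotient_mod V N) x A) (act (quotient_mod V N) y A)"
    proof -
      obtain n where "n \<in> N" "act V (x + y) v = vadd V (vadd V (act V x v) (act V y v)) n"
        using assms(1)[OF v] by blast
      then show ?thesis
        using v by (simp only: \<open>A = coset V N v\<close> quotient_simps closed)
          (rule coset_eqI[of _ _ n], simp_all add: closed sub_carrier)
    qed
    show "act (quotient_mod V N) (c *\<^sub>C x) A = vscale (quotient_mod V N) c (act (quotient_mod V N) x A)"
    proof -
      obtain n where "n \<in> N" "act V (c *\<^sub>C x) v = vadd V (vscale V c (act V x v)) n"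
        using assms(2)[OF v] by blast
      then show ?thesis
        using v by (simp only: \<open>A = coset V N v\<close> quotient_simps closed)
          (rule coset_eqI[of _ _ n], simp_all add: closed sub_carrier)
    qed
    show "act (quotient_mod V N) (bracket x y) A =
        vadd (quotient_mod V N) (act (quotient_mod V N) x (act (quotient_mod V N) y A))
          (vscale (quotient_mod V N) (- 1) (act (quotient_mod V N) y (act (quotient_mod V N) x A)))"
    proof -
      obtain n where "n \<in> N" "act V (bracket x y) v = vadd V (vadd V (act V x (act V y v)) (vscale V (- 1) (act V y (act V x v)))) n"
        using assms(3)[OF v] by blast
      then show ?thesis
        using v by (simp only: \<open>A = coset V N v\<close> quotient_simps closed)
          (rule coset_eqI[of _ _ n], simp_all add: closed sub_carrier)
    qed
  qed
qed

end

end

lemma (in lie_module) lie_module_quotient: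
  assumes N: "submodule N V"
  shows "lie_module (quotient_mod V N)"
proof (rule lie_module_quotient'[OF N])
  have z: "vzero V \<in> N" using N by (auto simp: submodule_def)
  fix x y v and c :: complex
  assume v: "v \<in> carrier V"
  show "\<exists>n\<in>N. act V (x + y) v = vadd V (vadd V (act V x v) (act V y v)) n"
    using v z by (intro bexI[of _ "vzero V"]) (simp_all add: add_act add_zero_right closed)
  show "\<exists>n\<in>N. act V (c *\<^sub>C x) v = vadd V (vscale V c (act V x v)) n"
    using v z by (intro bexI[of _ "vzero V"]) (simp_all add: scale_act add_zero_right closed)
  show "\<exists>n\<in>N. act V (bracket x y) v =
      vadd V (vadd V (act V x (act V y v)) (vscale V (- 1) (act V y (act V x v)))) n"
    using v z by (intro bexI[of _ "vzero V"]) (simp_all add: bracket_act add_zero_right closed)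
qed

section \<open>The induced module and its quotient\<close>

text \<open>The tensor product of a right and a left module over a complex algebra \<open>'r\<close> is the free
  vector space on pairs modulo the subspace \<open>tensor_rel\<close>.\<close>

definition pure_tensor :: "'m \<Rightarrow> 'n \<Rightarrow> ('m \<times> 'n \<Rightarrow>\<^sub>0 complex)" where
  "pure_tensor m n = Poly_Mapping.single (m, n) 1"

definition tensor_rel ::
    "('m \<Rightarrow> 'r \<Rightarrow> 'm) \<Rightarrow> ('r \<Rightarrow> 'n \<Rightarrow> 'n) \<Rightarrow>
     ('m :: complex_vec \<times> 'n :: complex_vec \<Rightarrow>\<^sub>0 complex) set" where
  "tensor_rel ract lact = cvec.span (
     {pure_tensor (m + m') n - pure_tensor m n - pure_tensor m' n | m m' n. True} \<union>
     {pure_tensor m (n + n') - pure_tensor m n - pure_tensor m n' | m n n'. True} \<union>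
     {pure_tensor (c *\<^sub>C m) n - c *\<^sub>C pure_tensor m n | c m n. True} \<union>
     {pure_tensor m (c *\<^sub>C n) - c *\<^sub>C pure_tensor m n | c m n. True} \<union>
     {pure_tensor (ract m r) n - pure_tensor m (lact r n) | m r n. True})"

text \<open>The right action of \<open>U(sv\<^sup>+)\<close> on \<open>U(sv)\<close>, and the action of \<open>U(sv\<^sup>+)\<close> on
  the one-dimensional module given by \<open>\<psi>\<close>.\<close>

definition right_act :: "sv uea \<Rightarrow> sv_plus uea \<Rightarrow> sv uea" where
  "right_act u a = u * uea_lift (\<lambda>x. uea_incl (Rep_sv_plus x)) a"

lemma lie_rep_sv_plus: "lie_rep (\<lambda>x. uea_incl (Rep_sv_plus x))"
  using lie_hom_Rep_sv_plus by (simp add: lie_rep_def lie_hom_def uea_incl_simps)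

definition psi_act :: "(sv_plus \<Rightarrow> complex) \<Rightarrow> sv_plus uea \<Rightarrow> complex \<Rightarrow> complex" where
  "psi_act \<psi> a \<alpha> = uea_lift \<psi> a * \<alpha>"

definition sv_tensor_free :: "(sv, sv uea \<times> complex \<Rightarrow>\<^sub>0 complex) lie_mod" where
  "sv_tensor_free =
    \<lparr>carrier = UNIV, vzero = 0, vadd = (+), vscale = scaleC,
     act = \<lambda>x. lin_ext (\<lambda>(u, \<alpha>). pure_tensor (uea_incl x * u) \<alpha>)\<rparr>"

definition W_mod :: "(sv_plus \<Rightarrow> complex) \<Rightarrow> (sv, (sv uea \<times> complex \<Rightarrow>\<^sub>0 complex) set) lie_mod" where
  "W_mod \<psi> = quotient_mod sv_tensor_free (tensor_rel right_act (psi_act \<psi>))"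

definition M0_shift_image :: "(sv_plus \<Rightarrow> complex) \<Rightarrow> complex \<Rightarrow> (sv uea \<times> complex \<Rightarrow>\<^sub>0 complex) set set" where
  "M0_shift_image \<psi> \<xi> =
    {vadd (W_mod \<psi>) (act (W_mod \<psi>) (svM 0) w) (vscale (W_mod \<psi>) (- \<xi>) w) | w. w \<in> carrier (W_mod \<psi>)}"

definition L_mod ::
    "(sv_plus \<Rightarrow> complex) \<Rightarrow> complex \<Rightarrow> (sv, (sv uea \<times> complex \<Rightarrow>\<^sub>0 complex) set set) lie_mod" where
  "L_mod \<psi> \<xi> = quotient_mod (W_mod \<psi>) (M0_shift_image \<psi> \<xi>)"

lemma action_space_sv_tensor_free: "action_space sv_tensor_free"
  by unfold_locales
    (simp_all add: sv_tensor_free_def scaleC_add_right scaleC_add_left scaleC_scaleC scaleC_one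
      lin_ext_add lin_ext_scale add.assoc add.commute add.left_commute)

lemma sv_tensor_free_act_pure:
  "act sv_tensor_free x (pure_tensor u \<alpha>) = pure_tensor (uea_incl x * u) \<alpha>"
  by (simp add: sv_tensor_free_def pure_tensor_def scaleC_one)

lemma sv_tensor_free_act_linear:
  "act sv_tensor_free x (p + q) = act sv_tensor_free x p + act sv_tensor_free x q"
  "act sv_tensor_free x (p - q) = act sv_tensor_free x p - act sv_tensor_free x q"
  "act sv_tensor_free x (c *\<^sub>C p) = c *\<^sub>C act sv_tensor_free x p"
  "act sv_tensor_free x 0 = 0"
  by (simp_all add: sv_tensor_free_def lin_ext_add lin_ext_diff lin_ext_scale)

lemma tensor_relI:
  "pure_tensor (m + m') n - pure_tensor m n - pure_tensor m' n \<in> tensor_rel ract lact"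
  "pure_tensor m (n + n') - pure_tensor m n - pure_tensor m n' \<in> tensor_rel ract lact"
  "pure_tensor (c *\<^sub>C m) n - c *\<^sub>C pure_tensor m n \<in> tensor_rel ract lact"
  "pure_tensor m (c *\<^sub>C n) - c *\<^sub>C pure_tensor m n \<in> tensor_rel ract lact"
  "pure_tensor (ract m r) n - pure_tensor m (lact r n) \<in> tensor_rel ract lact"
  unfolding tensor_rel_def by (rule cvec.span_base, blast)+

lemma right_act_mult: "right_act (v * u) a = v * right_act u a"
  by (simp add: right_act_def mult.assoc)

lemma submodule_tensor_rel: "submodule (tensor_rel right_act (psi_act \<psi>)) sv_tensor_free"
proof -
  let ?R = "tensor_rel right_act (psi_act \<psi>)"
  have act: "act sv_tensor_free x p \<in> ?R" if "p \<in> ?R" for x p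
    using that[unfolded tensor_rel_def]
  proof (induction rule: cvec.span_induct_alt)
    case base
    then show ?case by (simp add: sv_tensor_free_act_linear tensor_rel_def cvec.span_zero)
  next
    case (step c g q)
    have "act sv_tensor_free x g \<in> ?R"
      using step(1)
      by (auto simp: sv_tensor_free_act_linear sv_tensor_free_act_pure distrib_left
          scaleC_mult_right right_act_mult[symmetric] tensor_relI)
    then show ?case
      using step(2)
      by (auto simp: sv_tensor_free_act_linear tensor_rel_def intro: cvec.span_add cvec.span_scale)
  qed
  show ?thesis
    unfolding submodule_def using act
    by (auto simp: sv_tensor_free_def tensor_rel_def intro: cvec.span_add cvec.span_scale cvec.span_zero)
qed

lemma lie_module_W_mod: "lie_module (W_mod \<psi>)"
proof -
  let ?R = "tensor_rel right_act (psi_act \<psi>)"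
  let ?a = "act sv_tensor_free"
  have span: "p + q \<in> ?R" "c *\<^sub>C p \<in> ?R" if "p \<in> ?R" "q \<in> ?R" for p q c
    using that by (auto simp: tensor_rel_def intro: cvec.span_add cvec.span_scale)
  have R0: "0 \<in> ?R" by (simp add: tensor_rel_def cvec.span_zero)
  have free: "D p \<in> ?R"
    if "\<And>u \<alpha>. D (pure_tensor u \<alpha>) \<in> ?R" "\<And>p q. D (p + q) = D p + D q"
      "\<And>c p. D (c *\<^sub>C p) = c *\<^sub>C D p" "D 0 = 0"
    for D :: "(sv uea \<times> complex \<Rightarrow>\<^sub>0 complex) \<Rightarrow> _" and p
  proof (induction p rule: free_induct)
    case (single b)
    show ?case using that(1)[of "fst b" "snd b"] by (simp add: pure_tensor_def)
  qed (use that span R0 in auto)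
  have add: "?a (x + y) p - (?a x p + ?a y p) \<in> ?R" for x y p
  proof (rule free[where D = "\<lambda>p. ?a (x + y) p - (?a x p + ?a y p)"])
    fix u and \<alpha> :: complex
    show "?a (x + y) (pure_tensor u \<alpha>) - (?a x (pure_tensor u \<alpha>) + ?a y (pure_tensor u \<alpha>)) \<in> ?R"
      using tensor_relI(1)[of "uea_incl x * u" "uea_incl y * u" \<alpha> right_act "psi_act \<psi>"]
      by (simp add: uea_incl_simps sv_tensor_free_act_pure distrib_right diff_diff_eq)
  qed (simp_all add: sv_tensor_free_act_linear scaleC_add_right cvec.scale_right_diff_distrib)
  have scale: "?a (c *\<^sub>C x) p - c *\<^sub>C ?a x p \<in> ?R" for c x p
  proof (rule free[where D = "\<lambda>p. ?a (c *\<^sub>C x) p - c *\<^sub>C ?a x p"])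
    fix u and \<alpha> :: complex
    show "?a (c *\<^sub>C x) (pure_tensor u \<alpha>) - c *\<^sub>C ?a x (pure_tensor u \<alpha>) \<in> ?R"
      using tensor_relI(3)[of c "uea_incl x * u" \<alpha> right_act "psi_act \<psi>"]
      by (simp add: uea_incl_simps sv_tensor_free_act_pure scaleC_mult_left)
  qed (simp_all add: sv_tensor_free_act_linear scaleC_add_right cvec.scale_right_diff_distrib
        scaleC_scaleC mult.commute)
  have br: "?a (bracket x y) p - (?a x (?a y p) + (- 1) *\<^sub>C ?a y (?a x p)) \<in> ?R" for x y p
  proof (rule free[where D = "\<lambda>p. ?a (bracket x y) p - (?a x (?a y p) + (- 1) *\<^sub>C ?a y (?a x p))"])
    fix u and \<alpha> :: complex
    let ?v = "uea_incl x * (uea_incl y * u)" and ?w = "uea_incl y * (uea_incl x * u)"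
    have "(pure_tensor (?v + (- 1) *\<^sub>C ?w) \<alpha> - pure_tensor ?v \<alpha> - pure_tensor ((- 1) *\<^sub>C ?w) \<alpha>)
        + (pure_tensor ((- 1) *\<^sub>C ?w) \<alpha> - (- 1) *\<^sub>C pure_tensor ?w \<alpha>) \<in> ?R"
      by (intro span(1) tensor_relI)
    then show "?a (bracket x y) (pure_tensor u \<alpha>) - (?a x (?a y (pure_tensor u \<alpha>)) +
        (- 1) *\<^sub>C ?a y (?a x (pure_tensor u \<alpha>))) \<in> ?R"
      by (simp add: uea_incl_simps sv_tensor_free_act_pure left_diff_distrib mult.assoc scaleC_one
        diff_diff_eq2 diff_add_eq)
  qed (simp_all add: sv_tensor_free_act_linear scaleC_add_right cvec.scale_right_diff_distrib
        scaleC_scaleC scaleC_one)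
  have ex: "\<exists>n\<in>?R. a = b + n" if "a - b \<in> ?R" for a b
    using that by (intro bexI[of _ "a - b"]) auto
  interpret F: action_space sv_tensor_free by (rule action_space_sv_tensor_free)
  have ops: "vadd sv_tensor_free = (+)" "vscale sv_tensor_free = scaleC"
    by (simp_all add: sv_tensor_free_def)
  show ?thesis
    unfolding W_mod_def
    by (rule F.lie_module_quotient'[OF submodule_tensor_rel])
      (unfold ops, (rule ex, (rule add scale br))+)
qed

lemma svM_0_central: "bracket (svM 0) x = 0"
proof transfer
  fix x
  show "sv_bracket (Poly_Mapping.single (IM 0) 1) x = 0"
  proof (induction x rule: free_induct)
    case (single b)
    show ?case by (cases b) (simp_all add: sv_bracket_single)
  qed (simp_all add: sv_bracket_linear)
qed

lemma submodule_M0_shift_image: "submodule (M0_shift_image \<psi> \<xi>) (W_mod \<psi>)"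
proof -
  interpret W: lie_module "W_mod \<psi>" by (rule lie_module_W_mod)
  define T where "T w = vadd (W_mod \<psi>) (act (W_mod \<psi>) (svM 0) w) (vscale (W_mod \<psi>) (- \<xi>) w)" for w
  have image: "M0_shift_image \<psi> \<xi> = T ` carrier (W_mod \<psi>)"
    by (auto simp: M0_shift_image_def T_def)
  have T: "T w \<in> carrier (W_mod \<psi>)" if "w \<in> carrier (W_mod \<psi>)" for w
    using that by (simp add: T_def W.closed)
  have add: "vadd (W_mod \<psi>) (T v) (T w) = T (vadd (W_mod \<psi>) v w)"
    if "v \<in> carrier (W_mod \<psi>)" "w \<in> carrier (W_mod \<psi>)" for v w
    using that by (simp add: T_def W.act_add W.scale_add_right W.closed W.add_assoc W.add_left_commute)
  have scale: "vscale (W_mod \<psi>) c (T v) = T (vscale (W_mod \<psi>) c v)"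
    if "v \<in> carrier (W_mod \<psi>)" for c v
    using that by (simp add: T_def W.act_scale W.scale_add_right W.closed W.scale_scale mult.commute)
  have zero: "vzero (W_mod \<psi>) = T (vzero (W_mod \<psi>))"
  proof -
    have "vscale (W_mod \<psi>) 0 v = vzero (W_mod \<psi>)" if "v \<in> carrier (W_mod \<psi>)" for v
      using W.scale_add_left[OF that, of 1 "- 1"] W.add_inverse[OF that] that by (simp add: W.scale_one)
    then show ?thesis using scale[OF W.zero_closed, of 0] T W.zero_closed by metis
  qed
  have act: "act (W_mod \<psi>) x (T v) = T (act (W_mod \<psi>) x v)" if v: "v \<in> carrier (W_mod \<psi>)" for x v
  proof -
    let ?p = "act (W_mod \<psi>) (svM 0) (act (W_mod \<psi>) x v)"
    let ?q = "act (W_mod \<psi>) x (act (W_mod \<psi>) (svM 0) v)"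
    have z: "vadd (W_mod \<psi>) ?p (vscale (W_mod \<psi>) (- 1) ?q) = vzero (W_mod \<psi>)"
    proof -
      have "act (W_mod \<psi>) (0 *\<^sub>C svM 0) v = vscale (W_mod \<psi>) 0 (act (W_mod \<psi>) (svM 0) v)"
        using v by (rule W.scale_act)
      also have "\<dots> = vscale (W_mod \<psi>) (1 + - 1) (act (W_mod \<psi>) (svM 0) v)" by simp
      also have "\<dots> = vzero (W_mod \<psi>)"
        using v by (simp only: W.scale_add_left W.scale_one W.add_inverse W.act_closed)
      finally show ?thesis
        using W.bracket_act[OF v, of "svM 0" x] by (simp add: svM_0_central)
    qed
    have "?p = vadd (W_mod \<psi>) ?p (vadd (W_mod \<psi>) ?q (vscale (W_mod \<psi>) (- 1) ?q))"
      using v by (simp add: W.cancel_inverse W.closed)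
    also have "\<dots> = vadd (W_mod \<psi>) ?q (vadd (W_mod \<psi>) ?p (vscale (W_mod \<psi>) (- 1) ?q))"
      using v by (simp add: W.add_left_commute W.closed)
    also have "\<dots> = ?q"
      using v by (simp add: z W.add_zero_right W.closed)
    finally have "?p = ?q" .
    then show ?thesis
      using v by (simp add: T_def W.act_add W.act_scale W.closed)
  qed
  show ?thesis
    unfolding submodule_def image using T add scale act zero W.closed
    by (auto intro: image_eqI)
qed

lemma lie_module_L_mod: "lie_module (L_mod \<psi> \<xi>)"
  unfolding L_mod_def
  by (rule lie_module.lie_module_quotient[OF lie_module_W_mod submodule_M0_shift_image])

end

theory Submission
  imports Defs
begin

text \<open>
  Write $\mathfrak{p} = \mathfrak{sv}^+$ and let $\mathfrak{n}$ be the span of the remaining basis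
  vectors, which is a subalgebra too. A submodule of \<open>L_mod \<psi> \<xi>\<close> is produced as the set of
  vectors that are invisible to a suitable functional.

  The functional comes from the decomposition $\mathfrak{sv} = \mathfrak{n} \oplus \mathfrak{p}$. For
  a representation \<open>\<rho>\<close> of $\mathfrak{n}$ in an associative algebra there is a unique linear map
  \<open>gauss\<close>, named after the Gauss decomposition of matrices, on $U(\mathfrak{sv})$ with \<open>gauss (n * u) = \<rho> n * gauss u\<close>,
  \<open>gauss (u * p) = \<psi> p *\<^sub>C gauss u\<close> and \<open>gauss 1 = 1\<close>. It is computed by pushing letters from
  $\mathfrak{p}$ to the right end of a word at the cost of commutators, and it respects the
  relations of the enveloping algebra (\<open>gauss_word_commute\<close>) because of the Jacobi identity.

  Take for \<open>\<rho>\<close> the representation by upper triangular $2 \times 2$ matrices in which $L_0$ acts by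
  $\mathrm{diag}(0,1)$, $M_0$ by \<open>\<xi>\<close>, $M_{-1}$ by the matrix unit $E_{12}$, and all other basis
  vectors of $\mathfrak{n}$ by $0$. Since $M_0$ is central and acts by \<open>\<xi>\<close>, \<open>gauss\<close> is well defined on
  \<open>L_mod \<psi> \<xi>\<close> (\<open>gauss_class_L\<close>). The classes of those $t$ for which \<open>gauss (u * t)\<close> has upper left
  entry $0$ for every $u$ form a submodule. It is proper, because \<open>gauss 1 = 1\<close>.

  To see that it is nonzero, let $v$ be a Whittaker vector: an element on whose class every
  $x \in \mathfrak{p}$ acts by \<open>\<psi> x\<close>, as it does on the generator. By uniqueness of \<open>gauss\<close>,
  \<open>gauss (u * v) = gauss u * gauss v\<close> (\<open>gauss_mult_whittaker\<close>), so $v$ lies in the submodule as soon as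
  \<open>gauss v\<close> has upper left entry $0$, and its class is nonzero if \<open>gauss v\<close> is. Singularity of \<open>\<psi>\<close>
  provides such a $v$: for \<open>\<xi> = 0\<close> it is $M_{-1}$, and for \<open>\<xi> \<noteq> 0\<close> it is $L_0$ corrected by
  terms in $Y_{-1/2}$, $M_{-1}$, $M_{-2}$ and $M_{-1}^2$.
\<close>

section \<open>Derivations and multilinear functions on words\<close>

text \<open>
  The adjoint action of \<open>x\<close> extends to the tensor algebra as a derivation, replacing each letter \<open>y\<close> of
  a word in turn by \<open>bracket x y\<close>. This is the sum of the values of \<open>G\<close> over the words so obtained.
\<close>

primrec ad_sum :: "'g list \<Rightarrow> ('g list \<Rightarrow> 'a::comm_monoid_add) \<Rightarrow> 'g::complex_lie_algebra \<Rightarrow> 'a" where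
  "ad_sum [] G x = 0"
| "ad_sum (y # w) G x = G (bracket x y # w) + ad_sum w (\<lambda>v. G (y # v)) x"

text \<open>
  The derivation preserves the length of words. As a congruence rule this lets a function be defined by
  recursion on the length of a word through its own \<open>ad_sum\<close>.
\<close>

lemma ad_sum_cong [fundef_cong]:
  assumes "w = w'" "x = x'" "\<And>v. length v = length w' \<Longrightarrow> G v = G' v"
  shows "ad_sum w G x = ad_sum w' G' x'"
  using assms(3) unfolding assms(1,2)
proof (induction w' arbitrary: G G')
  case (Cons y v)
  have "ad_sum v (\<lambda>u. G (y # u)) x' = ad_sum v (\<lambda>u. G' (y # u)) x'"
    by (rule Cons.IH) (simp add: Cons.prems)
  then show ?case
    by (simp add: Cons.prems)
qed simp

lemma ad_sum_append:
  "ad_sum (u @ v) G x = ad_sum u (\<lambda>u'. G (u' @ v)) x + ad_sum v (\<lambda>v'. G (u @ v')) x"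
  by (induction u arbitrary: G) (auto simp: add.assoc)

lemma ad_sum_add_fun: "ad_sum w (\<lambda>v. G v + H v) x = ad_sum w G x + ad_sum w H x"
  by (induction w arbitrary: G H) (auto simp: algebra_simps)

lemma ad_sum_additive:
  assumes "h 0 = 0" "\<And>a b. h (a + b) = h a + h b"
  shows "h (ad_sum w G x) = ad_sum w (\<lambda>v. h (G v)) x"
  by (induction w arbitrary: G) (auto simp: assms)

lemma ad_sum_scale_fun: "ad_sum w (\<lambda>v. c *\<^sub>C G v) x = c *\<^sub>C ad_sum w G x"
  by (rule ad_sum_additive[symmetric]) (auto simp: scaleC_add_right)

lemma ad_sum_mult_left: "ad_sum w (\<lambda>v. (a::'a::ring) * G v) x = a * ad_sum w G x"
  by (rule ad_sum_additive[symmetric]) (auto simp: algebra_simps)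

lemma ad_sum_mult_right: "ad_sum w (\<lambda>v. G v * (a::'a::ring)) x = ad_sum w G x * a"
  by (rule ad_sum_additive[symmetric, where h = "\<lambda>t. t * a"]) (auto simp: algebra_simps)

text \<open>
  Linearity is asked for words of one fixed length only, since multilinearity of \<open>gauss_word\<close> below is
  proved by induction on the length.
\<close>

definition multilinear :: "nat \<Rightarrow> ('g::complex_vec list \<Rightarrow> 'a::complex_vec) \<Rightarrow> bool" where
  "multilinear n G \<longleftrightarrow> (\<forall>u v x y c. Suc (length u + length v) = n \<longrightarrow>
     G (u @ (c *\<^sub>C x + y) # v) = c *\<^sub>C G (u @ x # v) + G (u @ y # v))"

lemma multilinearD:
  "multilinear n G \<Longrightarrow> Suc (length u + length v) = n \<Longrightarrow>
    G (u @ (c *\<^sub>C x + y) # v) = c *\<^sub>C G (u @ x # v) + G (u @ y # v)"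
  by (auto simp: multilinear_def)

lemma multilinear_Cons: "multilinear (Suc n) G \<Longrightarrow> multilinear n (\<lambda>v. G (y # v))"
  using multilinearD[of "Suc n" G "y # _"] by (simp add: multilinear_def)

lemma ad_sum_linear:
  assumes "multilinear (length w) G"
  shows "ad_sum w G (c *\<^sub>C x + y) = c *\<^sub>C ad_sum w G x + ad_sum w G y"
  using assms
proof (induction w arbitrary: G)
  case (Cons z w)
  have "G (bracket (c *\<^sub>C x + y) z # w) = c *\<^sub>C G (bracket x z # w) + G (bracket y z # w)"
    using multilinearD[OF Cons.prems, of "[]" w c "bracket x z" "bracket y z"]
    by (simp add: bracket_add_left bracket_scale_left)
  then show ?case
    using Cons.IH[OF multilinear_Cons[where y = z and G = G]] Cons.prems
    by (simp add: scaleC_add_right algebra_simps)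
qed simp

lemma multilinear_ad_sum:
  assumes "multilinear n G"
  shows "multilinear n (\<lambda>w. ad_sum w G z)"
  unfolding multilinear_def
proof (intro allI impI)
  fix u v :: "'a list" and x y c
  assume n: "Suc (length u + length v) = n"
  note lin = multilinearD[OF assms]
  have "ad_sum u (\<lambda>u'. G (u' @ (c *\<^sub>C x + y) # v)) z
      = ad_sum u (\<lambda>u'. c *\<^sub>C G (u' @ x # v) + G (u' @ y # v)) z"
    by (rule ad_sum_cong) (use n lin in auto)
  moreover have "ad_sum v (\<lambda>v'. G (u @ (c *\<^sub>C x + y) # v')) z
      = ad_sum v (\<lambda>v'. c *\<^sub>C G (u @ x # v') + G (u @ y # v')) z"
    by (rule ad_sum_cong) (use n lin in auto)
  moreover have "G (u @ bracket z (c *\<^sub>C x + y) # v)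
      = c *\<^sub>C G (u @ bracket z x # v) + G (u @ bracket z y # v)"
    using lin[OF n] by (simp only: bracket_add_right bracket_scale_right)
  ultimately show "ad_sum (u @ (c *\<^sub>C x + y) # v) G z
      = c *\<^sub>C ad_sum (u @ x # v) G z + ad_sum (u @ y # v) G z"
    by (simp only: ad_sum_append ad_sum.simps ad_sum_add_fun ad_sum_scale_fun)
      (simp only: scaleC_add_right ac_simps)
qed

lemma multilinear_add:
  assumes "\<And>n. multilinear n G"
  shows "G (u @ (x + y) # v) = G (u @ x # v) + G (u @ y # v)"
  using multilinearD[OF assms refl, where c = 1] by (simp add: scaleC_one)

lemma multilinear_minus:
  assumes "\<And>n. multilinear n G"
  shows "G (u @ (x - y) # v) = G (u @ x # v) - G (u @ y # v)"
  using multilinear_add[OF assms, of u "x - y" y v] by (simp add: algebra_simps)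

lemma jacobi_derivation:
  "bracket x (bracket y z) = bracket (bracket x y) z + bracket y (bracket x z)"
    for x :: "'g::complex_lie_algebra"
proof -
  have "bracket y (bracket x z + bracket z x) = 0"
    using bracket_antisym[of z x] by simp
  then have "bracket y (bracket z x) = - bracket y (bracket x z)"
    by (simp add: bracket_add_right eq_neg_iff_add_eq_0 add.commute)
  then have "bracket x (bracket y z) + - bracket y (bracket x z) + - bracket (bracket x y) z = 0"
    using jacobi[of x y z] unfolding bracket_antisym[of z "bracket x y"] by simp
  then show ?thesis
    by (simp add: algebra_simps)
qed

text \<open>
  The adjoint action on the tensor algebra is a Lie algebra action. The outer sum acts on the word
  first, so the left-hand side evaluates \<open>G\<close> after the derivation \<open>y\<close> followed by \<open>x\<close>.
\<close>

lemma ad_sum_bracket: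
  assumes "\<And>n. multilinear n G"
  shows "ad_sum w (\<lambda>v. ad_sum v G x) y =
    ad_sum w (\<lambda>v. ad_sum v G y) x + ad_sum w G (bracket x y)"
  using assms
proof (induction w arbitrary: G)
  case (Cons z w)
  have "G (bracket x (bracket y z) # w) = G (bracket (bracket x y) z # w) + G (bracket y (bracket x z) # w)"
    using multilinear_add[OF Cons.prems, of "[]" _ _ w] by (simp add: jacobi_derivation[of x y z])
  then show ?case
    using Cons.IH[of "\<lambda>v. G (z # v)"] multilinear_Cons[OF Cons.prems]
    by (simp add: ad_sum_add_fun algebra_simps)
qed simp

section \<open>Words in the enveloping algebra\<close>

lemma prod_list_uea_incl: "prod_list (map uea_incl w) = abs_uea (Poly_Mapping.single (Word w) 1)"
proof (induction w)
  case Nil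
  show ?case by (simp add: one_uea.abs_eq flip: zero_word_def)
next
  case (Cons x w)
  then show ?case
    by (simp add: uea_incl.abs_eq times_uea.abs_eq letter_def mult_single plus_word_def)
qed

lemma uea_word_induct [case_names add scale word]:
  assumes "\<And>u v. P u \<Longrightarrow> P v \<Longrightarrow> P (u + v)" "\<And>c u. P u \<Longrightarrow> P (c *\<^sub>C u)"
    "\<And>w. P (prod_list (map uea_incl w))"
  shows "P u"
proof (induction u rule: uea.abs_induct)
  case (1 p)
  show ?case
  proof (induction p rule: free_induct)
    case zero
    show ?case using assms(2)[OF assms(3), of 0] by (simp add: zero_uea.abs_eq)
  next
    case (add p q)
    then show ?case using assms(1) by (simp flip: plus_uea.abs_eq)
  next
    case (scale c p)
    then show ?case using assms(2) by (simp flip: scaleC_uea.abs_eq)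
  next
    case (single w)
    show ?case using assms(3)[of "letters w"] by (simp add: prod_list_uea_incl)
  qed
qed

lemma uea_incl_zero: "uea_incl 0 = 0"
  using uea_incl_simps(2)[of 0 0] by simp

lemma uea_incl_minus: "uea_incl (- x) = - uea_incl x"
  using uea_incl_simps(2)[of "- 1" x] by simp

text \<open>The identity that the recursion for \<open>gauss_word\<close> below imitates.\<close>

lemma uea_incl_mult_word:
  "uea_incl x * prod_list (map uea_incl w) =
    prod_list (map uea_incl w) * uea_incl x + ad_sum w (\<lambda>v. prod_list (map uea_incl v)) x"
proof (induction w)
  case (Cons y w)
  have "uea_incl x * (uea_incl y * prod_list (map uea_incl w))
      = uea_incl (bracket x y) * prod_list (map uea_incl w)
        + uea_incl y * (uea_incl x * prod_list (map uea_incl w))"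
    by (simp add: uea_incl_simps left_diff_distrib mult.assoc)
  then show ?case
    by (simp add: Cons.IH distrib_left ad_sum_mult_left algebra_simps)
qed simp

section \<open>The Gauss map of a Lie algebra split into two subalgebras\<close>

text \<open>
  \<open>pr\<close> is a projection whose image and kernel are both subalgebras. The linear map \<open>\<mu>\<close> is a
  representation of the kernel and a character of the image; the values of the character are only
  required to be central, which covers scalar multiples of \<open>1\<close>.
\<close>

locale split_representation =
  fixes pr :: "'g::complex_lie_algebra \<Rightarrow> 'g" and \<mu> :: "'g \<Rightarrow> 'a::complex_algebra"
  assumes pr_linear: "pr (c *\<^sub>C x + y) = c *\<^sub>C pr x + pr y"
    and pr_pr: "pr (pr x) = pr x"
    and pr_bracket: "pr x = x \<Longrightarrow> pr y = y \<Longrightarrow> pr (bracket x y) = bracket x y"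
    and ker_bracket: "pr x = 0 \<Longrightarrow> pr y = 0 \<Longrightarrow> pr (bracket x y) = 0"
    and \<mu>_linear: "\<mu> (c *\<^sub>C x + y) = c *\<^sub>C \<mu> x + \<mu> y"
    and \<mu>_central: "pr x = x \<Longrightarrow> \<mu> x * a = a * \<mu> x"
    and \<mu>_bracket_pr: "pr x = x \<Longrightarrow> pr y = y \<Longrightarrow> \<mu> (bracket x y) = 0"
    and \<mu>_bracket_ker: "pr x = 0 \<Longrightarrow> pr y = 0 \<Longrightarrow> \<mu> (bracket x y) = \<mu> x * \<mu> y - \<mu> y * \<mu> x"
begin

lemma pr_add: "pr (x + y) = pr x + pr y"
  using pr_linear[of 1 x y] by (simp add: scaleC_one)

lemma pr_diff: "pr (x - y) = pr x - pr y"
  using pr_add[of "x - y" y] by (simp add: algebra_simps)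

lemma \<mu>_add: "\<mu> (x + y) = \<mu> x + \<mu> y"
  using \<mu>_linear[of 1 x y] by (simp add: scaleC_one)

text \<open>
  A first letter from the kernel of \<open>pr\<close> acts on the value from the left. A first letter \<open>x\<close> from the
  image is moved to the right end, where it contributes the central factor \<open>\<mu> x\<close>, and leaves behind
  the derivation of the rest of the word. Both cases are covered by one clause because \<open>x\<close> splits
  as \<open>(x - pr x) + pr x\<close> and \<open>\<mu>\<close> is linear.
\<close>

function gauss_word :: "'g list \<Rightarrow> 'a" where
  "gauss_word [] = 1"
| "gauss_word (x # w) = \<mu> x * gauss_word w + ad_sum w gauss_word (pr x)"
  by pat_completeness auto
termination
  by (relation "measure length") auto

lemma multilinear_gauss_word: "multilinear n gauss_word"
proof (induction n)
  case (Suc n)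
  show ?case
    unfolding multilinear_def
  proof (intro allI impI)
    fix u v :: "'g list" and x y c
    assume n: "Suc (length u + length v) = Suc n"
    show "gauss_word (u @ (c *\<^sub>C x + y) # v) = c *\<^sub>C gauss_word (u @ x # v) + gauss_word (u @ y # v)"
    proof (cases u)
      case Nil
      then show ?thesis
        using n Suc.IH ad_sum_linear[of v gauss_word c "pr x" "pr y"]
        by (simp add: \<mu>_linear pr_linear scaleC_add_right distrib_right scaleC_mult_left)
    next
      case (Cons z u')
      then show ?thesis
        using n multilinearD[OF Suc.IH, of u' v c x y]
          multilinearD[OF multilinear_ad_sum[OF Suc.IH], of u' v c x y "pr z"]
        by (simp add: scaleC_add_right distrib_left scaleC_mult_right algebra_simps)
    qed
  qed
qed (simp add: multilinear_def)

lemmas gauss_word_add = multilinear_add[OF multilinear_gauss_word]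
lemmas gauss_word_minus = multilinear_minus[OF multilinear_gauss_word]

lemma ad_sum_gauss_word_add:
  "ad_sum w gauss_word (x + y) = ad_sum w gauss_word x + ad_sum w gauss_word y"
  using ad_sum_linear[OF multilinear_gauss_word, of w 1 x y] by (simp add: scaleC_one)

lemma gauss_word_ker: "pr x = 0 \<Longrightarrow> gauss_word (x # w) = \<mu> x * gauss_word w"
  using ad_sum_gauss_word_add[of w 0 0] by simp

text \<open>
  The relation at the front of a word. By bilinearity each of \<open>x\<close> and \<open>y\<close> can be taken from the kernel
  or the image of \<open>pr\<close>. Two letters from the kernel need that \<open>\<mu>\<close> is a representation there. For one of
  each the recursion for \<open>x\<close> is the statement, as \<open>\<mu> x\<close> is central. For two letters from the image the
  second-order terms are handled by \<open>ad_sum_bracket\<close>, and \<open>\<mu>\<close> vanishes on \<open>bracket x y\<close>.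
\<close>

lemma gauss_word_commute_Nil:
  "gauss_word (x # y # w) = gauss_word (y # x # w) + gauss_word (bracket x y # w)"
proof -
  define D where "D x y = gauss_word (x # y # w) - gauss_word (y # x # w) - gauss_word (bracket x y # w)" for x y
  have add: "D (x + x') y = D x y + D x' y" for x x' y
    using gauss_word_add[of "[]"] gauss_word_add[of "[_]"]
    by (simp add: D_def bracket_add_left del: gauss_word.simps)
  have neg: "gauss_word (bracket y x # w) = - gauss_word (bracket x y # w)" for x y
    using gauss_word_minus[of "[]" 0 "bracket x y" w] gauss_word_minus[of "[]" 0 0 w]
    unfolding bracket_antisym[of y x] by (simp del: gauss_word.simps)
  \<comment> \<open>With antisymmetry, additivity in the first argument reduces both arguments to the two halves.\<close>
  have anti: "D x y = - D y x" for x y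
    using neg[of x y] by (simp add: D_def del: gauss_word.simps)
  have nn: "D x y = 0" if "pr x = 0" "pr y = 0" for x y
    using that by (simp add: D_def gauss_word_ker ker_bracket \<mu>_bracket_ker left_diff_distrib mult.assoc
        del: gauss_word.simps)
  have pn: "D x y = 0" if x: "pr x = x" and y: "pr y = 0" for x y
  proof -
    have "ad_sum w (\<lambda>v. gauss_word (y # v)) x = \<mu> y * ad_sum w gauss_word x"
      by (simp only: gauss_word_ker[OF y] ad_sum_mult_left)
    moreover have comm: "\<mu> x * (\<mu> y * gauss_word w) = \<mu> y * (\<mu> x * gauss_word w)"
      using \<mu>_central[OF x, of "\<mu> y"] by (simp flip: mult.assoc)
    ultimately show ?thesis
      unfolding D_def gauss_word_ker[OF y] gauss_word.simps(2)[of x] x ad_sum.simps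
      using comm by (simp add: distrib_left del: gauss_word.simps)
  qed
  have pp: "D x y = 0" if x: "pr x = x" and y: "pr y = y" for x y
  proof -
    have exp: "gauss_word (x # y # w) = gauss_word (bracket x y # w)
        + (\<mu> x * (\<mu> y * gauss_word w) + \<mu> x * ad_sum w gauss_word y
        + \<mu> y * ad_sum w gauss_word x) + ad_sum w (\<lambda>v. ad_sum v gauss_word y) x"
      if "pr x = x" "pr y = y" for x y
      unfolding gauss_word.simps(2)[of x] gauss_word.simps(2)[of y] that ad_sum.simps
        ad_sum_add_fun ad_sum_mult_left distrib_left by (simp add: algebra_simps)
    have "gauss_word (bracket x y # w) = ad_sum w gauss_word (bracket x y)"
      by (simp add: \<mu>_bracket_pr pr_bracket x y)
    moreover have "\<mu> x * (\<mu> y * gauss_word w) = \<mu> y * (\<mu> x * gauss_word w)"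
      using \<mu>_central[OF x, of "\<mu> y"] by (simp flip: mult.assoc)
    ultimately show ?thesis
      unfolding D_def exp[OF x y] exp[OF y x] neg[of x y]
      using ad_sum_bracket[OF multilinear_gauss_word, of w x y]
      by (simp add: algebra_simps del: gauss_word.simps)
  qed
  have split: "D x y = D (pr x) y + D (x - pr x) y" for x y
    using add[of "pr x" "x - pr x" y] by simp
  have ker: "pr (x - pr x) = 0" for x by (simp add: pr_diff pr_pr)
  have p: "D x y = 0" if "pr x = x" for x y
    using split[of y x] anti[of x y] anti[of "pr y" x] anti[of "y - pr y" x] pp[OF that pr_pr, of y]
      pn[OF that ker, of y] by (simp add: pr_pr)
  have "D x y = 0" if "pr x = 0" for x y
    using split[of y x] anti[of x y] p[OF pr_pr, of y x] nn[OF ker that, of y] by simp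
  then have "D x y = 0"
    using split[of x y] p[OF pr_pr, of x y] ker[of x] by simp
  then show ?thesis by (simp add: D_def algebra_simps del: gauss_word.simps)
qed

text \<open>
  The relation anywhere in a word follows because the recursion applies a derivation to it, and by the
  Jacobi identity a derivation maps the relation for \<open>x\<close> and \<open>y\<close> to sums of such relations, now behind
  a shorter prefix.
\<close>

lemma gauss_word_commute:
  "gauss_word (a @ x # y # b) = gauss_word (a @ y # x # b) + gauss_word (a @ bracket x y # b)"
proof (induction "length a" arbitrary: a b x y)
  case 0
  then have "a = []" by simp
  then show ?case by (simp only: append_Nil gauss_word_commute_Nil[of x y b])
next
  case (Suc n)
  then obtain c a' where a: "a = c # a'" and n: "n = length a'" by (cases a) auto
  define z where "z = pr c"
  have IH: "gauss_word (v @ x # y # b) = gauss_word (v @ y # x # b) + gauss_word (v @ bracket x y # b)"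
    if "length v = length a'" for v b x y
    by (rule Suc.hyps(1)) (simp add: that n)
  have 1: "ad_sum a' (\<lambda>v. gauss_word (v @ x # y # b)) z
      = ad_sum a' (\<lambda>v. gauss_word (v @ y # x # b)) z + ad_sum a' (\<lambda>v. gauss_word (v @ bracket x y # b)) z"
    unfolding ad_sum_add_fun[symmetric] by (intro ad_sum_cong refl IH)
  have 2: "ad_sum b (\<lambda>v. gauss_word (a' @ x # y # v)) z
      = ad_sum b (\<lambda>v. gauss_word (a' @ y # x # v)) z + ad_sum b (\<lambda>v. gauss_word (a' @ bracket x y # v)) z"
    unfolding ad_sum_add_fun[symmetric] by (intro ad_sum_cong refl IH)
  \<comment> \<open>The derivation hits \<open>x\<close> or \<open>y\<close>: sort both words by the induction hypothesis and apply Jacobi.\<close>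
  have 3: "gauss_word (a' @ bracket z x # y # b) + gauss_word (a' @ x # bracket z y # b)
      = gauss_word (a' @ bracket z y # x # b) + gauss_word (a' @ y # bracket z x # b)
        + gauss_word (a' @ bracket z (bracket x y) # b)"
    unfolding jacobi_derivation[of z x y] gauss_word_add
      IH[OF refl, of "bracket z x" y b] IH[OF refl, of x "bracket z y" b] by (simp add: algebra_simps)
  have expand2: "gauss_word (a @ s # t # b) = \<mu> c * gauss_word (a' @ s # t # b)
      + (ad_sum a' (\<lambda>v. gauss_word (v @ s # t # b)) z + ad_sum b (\<lambda>v. gauss_word (a' @ s # t # v)) z)
      + (gauss_word (a' @ bracket z s # t # b) + gauss_word (a' @ s # bracket z t # b))" for s t
    by (simp add: a z_def ad_sum_append)
  have expand1: "gauss_word (a @ s # b) = \<mu> c * gauss_word (a' @ s # b)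
      + (ad_sum a' (\<lambda>v. gauss_word (v @ s # b)) z + ad_sum b (\<lambda>v. gauss_word (a' @ s # v)) z)
      + gauss_word (a' @ bracket z s # b)" for s
    by (simp add: a z_def ad_sum_append)
  show ?case
    unfolding expand2 expand1 1 2 3 IH[OF refl, of x y b] by (simp add: distrib_left)
qed

text \<open>
  Right equivariance is not built into the recursion. In the induction step the extra term of the
  derivation ends in \<open>bracket (pr c) x\<close>, which lies in the image of \<open>pr\<close> and on which \<open>\<mu>\<close> vanishes.
\<close>

lemma gauss_word_snoc:
  assumes "pr x = x"
  shows "gauss_word (w @ [x]) = gauss_word w * \<mu> x"
  using assms
proof (induction "length w" arbitrary: w x)
  case (Suc n)
  then obtain c w' where w: "w = c # w'" and n: "n = length w'" by (cases w) auto
  have IH: "gauss_word (v @ [x]) = gauss_word v * \<mu> x" if "length v = length w'" "pr x = x" for v x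
    using Suc.hyps(1)[of v x] that n by simp
  have "ad_sum w' (\<lambda>v. gauss_word (v @ [x])) (pr c) = ad_sum w' (\<lambda>v. gauss_word v * \<mu> x) (pr c)"
    by (rule ad_sum_cong) (use IH Suc.prems in auto)
  moreover have "gauss_word (w' @ [bracket (pr c) x]) = 0"
    using IH[OF refl, of "bracket (pr c) x"] Suc.prems by (simp add: pr_bracket pr_pr \<mu>_bracket_pr)
  ultimately show ?case
    using IH[OF refl Suc.prems]
    by (simp add: w ad_sum_append ad_sum_mult_right distrib_right mult.assoc)
qed simp

subsection \<open>Descent to the enveloping algebra\<close>

definition gauss_free :: "('g word \<Rightarrow>\<^sub>0 complex) \<Rightarrow> 'a" where
  "gauss_free = lin_ext (\<lambda>w. gauss_word (letters w))"

lemma gauss_free_linear: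
  "gauss_free (p + q) = gauss_free p + gauss_free q"
  "gauss_free (p - q) = gauss_free p - gauss_free q"
  "gauss_free (c *\<^sub>C p) = c *\<^sub>C gauss_free p"
  "gauss_free 0 = 0"
  by (simp_all add: gauss_free_def lin_ext_add lin_ext_diff lin_ext_scale)

lemma gauss_free_word: "gauss_free (Poly_Mapping.single w 1) = gauss_word (letters w)"
  by (simp add: gauss_free_def scaleC_one)

lemma gauss_free_sandwich:
  assumes "\<And>u v. gauss_free (Poly_Mapping.single (Word u) 1 * p * Poly_Mapping.single (Word v) 1) = 0"
  shows "gauss_free (a * p * b) = 0"
proof (induction a rule: free_induct)
  case (single u)
  show ?case
  proof (induction b rule: free_induct)
    case (single v)
    show ?case using assms[of "letters u" "letters v"] by simp
  qed (simp_all add: gauss_free_linear distrib_left free_scale_mult)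
qed (simp_all add: gauss_free_linear distrib_right free_scale_mult)

lemma gauss_free_ideal:
  assumes "p \<in> uea_ideal"
  shows "gauss_free (a * p * b) = 0"
  using assms
proof (induction arbitrary: a b)
  case (add x y)
  show ?case
    by (rule gauss_free_sandwich)
      (simp add: letter_def left_diff_distrib right_diff_distrib mult_single plus_word_def
        gauss_free_linear gauss_free_word gauss_word_add)
next
  case (scale c x)
  show ?case
  proof (rule gauss_free_sandwich)
    fix u v
    have "gauss_word (u @ 0 # v) = 0"
      using gauss_word_minus[of u 0 0 v] by (simp only: diff_self)
    then have "gauss_word (u @ (c *\<^sub>C x) # v) = c *\<^sub>C gauss_word (u @ x # v)"
      using multilinearD[OF multilinear_gauss_word refl, where u = u and v = v and c = c and x = x and y = 0]
      by (simp only: add_0_right)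
    then show "gauss_free (Poly_Mapping.single (Word u) 1 * (letter (c *\<^sub>C x) - c *\<^sub>C letter x)
        * Poly_Mapping.single (Word v) 1) = 0"
      by (simp add: letter_def left_diff_distrib right_diff_distrib mult_single plus_word_def
          free_scale_mult gauss_free_linear gauss_free_word)
  qed
next
  case (bracket x y)
  show ?case
  proof (rule gauss_free_sandwich)
    fix u v
    show "gauss_free (Poly_Mapping.single (Word u) 1 * (letter x * letter y - letter y * letter x
        - letter (bracket x y)) * Poly_Mapping.single (Word v) 1) = 0"
      using gauss_word_commute[of u x y v]
      by (simp add: letter_def left_diff_distrib right_diff_distrib mult_single plus_word_def
          gauss_free_linear gauss_free_word)
  qed
next
  case (mult p c d)
  show ?case using mult.IH[of "a * c" "d * b"] by (simp add: mult.assoc)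
qed (simp_all add: gauss_free_linear distrib_left distrib_right)

definition gauss :: "'g uea \<Rightarrow> 'a" where
  "gauss u = gauss_free (rep_uea u)"

lemma gauss_abs: "gauss (abs_uea p) = gauss_free p"
proof -
  have "uea_rel (rep_uea (abs_uea p)) p"
    by (rule rep_abs_rsp_left[OF Quotient3_uea uea_rel_refl])
  then show ?thesis
    using gauss_free_ideal[of "rep_uea (abs_uea p) - p" 1 1]
    by (simp add: gauss_def uea_rel_def gauss_free_linear)
qed

lemma gauss_add: "gauss (u + v) = gauss u + gauss v"
  by (induction u rule: uea.abs_induct; induction v rule: uea.abs_induct) (simp add: gauss_abs plus_uea.abs_eq gauss_free_linear)

lemma gauss_scale: "gauss (c *\<^sub>C u) = c *\<^sub>C gauss u"
  by (induction u rule: uea.abs_induct) (simp add: gauss_abs scaleC_uea.abs_eq gauss_free_linear)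

lemma gauss_minus: "gauss (- u) = - gauss u"
  using gauss_scale[of "- 1" u] by simp

lemma gauss_diff: "gauss (u - v) = gauss u - gauss v"
  using gauss_add[of "u - v" v] by simp

lemma gauss_zero: "gauss 0 = 0"
  using gauss_diff[of 0 0] by simp

lemma gauss_words: "gauss (prod_list (map uea_incl w)) = gauss_word w"
  by (simp add: prod_list_uea_incl gauss_abs gauss_free_word)

lemma gauss_one: "gauss 1 = 1"
  using gauss_words[of "[]"] by simp

lemma gauss_ker_mult:
  assumes "pr x = 0"
  shows "gauss (uea_incl x * u) = \<mu> x * gauss u"
proof (induction u rule: uea_word_induct)
  case (word w)
  show ?case
    using gauss_words[of "x # w"] gauss_word_ker[OF assms, of w] by (simp add: gauss_words del: gauss_word.simps)
qed (simp_all add: gauss_add gauss_scale distrib_left scaleC_mult_right)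

lemma gauss_mult_pr:
  assumes "pr x = x"
  shows "gauss (u * uea_incl x) = gauss u * \<mu> x"
proof (induction u rule: uea_word_induct)
  case (word w)
  show ?case
    using gauss_words[of "w @ [x]"] gauss_word_snoc[OF assms, of w] by (simp add: gauss_words)
qed (simp_all add: gauss_add gauss_scale distrib_right scaleC_mult_left)

text \<open>
  A map with the same equivariance on both sides satisfies the same recursion on words, so it is
  determined by its value at \<open>1\<close>.
\<close>

lemma gauss_unique:
  assumes add: "\<And>u v. H (u + v) = H u + H v"
    and scale: "\<And>c u. H (c *\<^sub>C u) = c *\<^sub>C H u"
    and ker: "\<And>x u. pr x = 0 \<Longrightarrow> H (uea_incl x * u) = \<mu> x * H u"
    and pr: "\<And>x u. pr x = x \<Longrightarrow> H (u * uea_incl x) = H u * \<mu> x"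
  shows "H u = gauss u * H 1"
proof (induction u rule: uea_word_induct)
  case (word w)
  have "H (prod_list (map uea_incl w)) = gauss_word w * H 1"
  proof (induction "length w" arbitrary: w)
    case (Suc n)
    then obtain x v where w: "w = x # v" and n: "n = length v" by (cases w) auto
    let ?E = "\<lambda>v. prod_list (map uea_incl v)"
    have IH: "H (?E v') = gauss_word v' * H 1" if "length v' = length v" for v'
      using Suc.hyps(1)[of v'] that n by simp
    have H0: "H 0 = 0" using scale[of 0 0] by simp
    have x: "uea_incl x = uea_incl (x - pr x) + uea_incl (pr x)"
      using uea_incl_simps(1)[of "x - pr x" "pr x"] by simp
    have "H (?E w) = \<mu> (x - pr x) * H (?E v) + H (uea_incl (pr x) * ?E v)"
      by (simp add: w x distrib_right add ker pr_diff pr_pr)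
    also have "H (uea_incl (pr x) * ?E v) = H (?E v) * \<mu> (pr x) + ad_sum v (\<lambda>v'. H (?E v')) (pr x)"
      by (simp add: uea_incl_mult_word add pr pr_pr ad_sum_additive[of H, OF H0 add])
    also have "ad_sum v (\<lambda>v'. H (?E v')) (pr x) = ad_sum v (\<lambda>v'. gauss_word v' * H 1) (pr x)"
      by (intro ad_sum_cong refl IH)
    also have "H (?E v) * \<mu> (pr x) = \<mu> (pr x) * H (?E v)"
      by (simp add: \<mu>_central pr_pr)
    also have "\<mu> (x - pr x) * H (?E v) + (\<mu> (pr x) * H (?E v) + ad_sum v (\<lambda>v'. gauss_word v' * H 1) (pr x))
        = gauss_word w * H 1"
      using \<mu>_add[of "x - pr x" "pr x"]
      by (simp add: IH[OF refl] w ad_sum_mult_right distrib_right mult.assoc flip: add.assoc)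
    finally show ?case .
  qed simp
  then show ?case by (simp add: gauss_words)
qed (simp_all add: gauss_add gauss_scale add scale distrib_right scaleC_mult_left)

end

section \<open>The splitting of the Schroedinger-Virasoro algebra\<close>

subsection \<open>Upper triangular matrices\<close>

datatype upper_tri = UT (ent11: complex) (ent12: complex) (ent22: complex)

instantiation upper_tri :: complex_algebra
begin

definition "0 = UT 0 0 0"
definition "1 = UT 1 0 1"
definition "A + B = UT (ent11 A + ent11 B) (ent12 A + ent12 B) (ent22 A + ent22 B)"
definition "A - B = UT (ent11 A - ent11 B) (ent12 A - ent12 B) (ent22 A - ent22 B)"
definition "- A = UT (- ent11 A) (- ent12 A) (- ent22 A)"
definition "A * B = UT (ent11 A * ent11 B) (ent11 A * ent12 B + ent12 A * ent22 B) (ent22 A * ent22 B)"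
definition "c *\<^sub>C A = UT (c * ent11 A) (c * ent12 A) (c * ent22 A)"

lemmas upper_tri_defs = zero_upper_tri_def one_upper_tri_def plus_upper_tri_def
  minus_upper_tri_def uminus_upper_tri_def times_upper_tri_def scaleC_upper_tri_def

instance
  by standard (simp_all add: upper_tri_defs algebra_simps)

end

subsection \<open>The positive half and its complement\<close>

definition sv_basis :: "sv_index \<Rightarrow> sv" where
  "sv_basis i = Abs_sv (Poly_Mapping.single i 1)"

lemma sv_basis_simps: "sv_basis (IL n) = svL n" "sv_basis (IM n) = svM n" "sv_basis (IY n) = svY n"
  by (simp_all add: sv_basis_def svL_def svM_def svY_def)

lemma sv_induct [case_names add scale basis]:
  assumes "\<And>x y. P x \<Longrightarrow> P y \<Longrightarrow> P (x + y)" "\<And>c x. P x \<Longrightarrow> P (c *\<^sub>C x)" "\<And>i. P (sv_basis i)"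
  shows "P x"
proof -
  have "P (Abs_sv p)" for p
  proof (induction p rule: free_induct)
    case zero
    show ?case using assms(2)[OF assms(3), of 0] by (simp add: zero_sv_def)
  next
    case (add p q)
    then show ?case using assms(1)[of "Abs_sv p" "Abs_sv q"] by (simp add: plus_sv.abs_eq eq_onp_same_args)
  next
    case (scale c p)
    then show ?case using assms(2)[of "Abs_sv p" c] by (simp add: scaleC_sv.abs_eq eq_onp_same_args)
  next
    case (single i)
    show ?case using assms(3)[of i] by (simp add: sv_basis_def)
  qed
  from this[of "Rep_sv x"] show ?thesis by (simp add: Rep_sv_inverse)
qed

definition sv_linear :: "(sv_index \<Rightarrow> 'a::complex_vec) \<Rightarrow> sv \<Rightarrow> 'a" where
  "sv_linear f x = lin_ext f (Rep_sv x)"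

lemma sv_linear_simps:
  "sv_linear f (x + y) = sv_linear f x + sv_linear f y"
  "sv_linear f (x - y) = sv_linear f x - sv_linear f y"
  "sv_linear f (- x) = - sv_linear f x"
  "sv_linear f (c *\<^sub>C x) = c *\<^sub>C sv_linear f x"
  "sv_linear f 0 = 0"
  "sv_linear f (sv_basis i) = f i"
  by (simp_all add: sv_linear_def plus_sv.rep_eq minus_sv.rep_eq uminus_sv.rep_eq scaleC_sv.rep_eq
      zero_sv.rep_eq lin_ext_add lin_ext_diff lin_ext_uminus lin_ext_scale sv_basis_def Abs_sv_inverse
      scaleC_one)

fun positive :: "sv_index \<Rightarrow> bool" where
  "positive (IL n) \<longleftrightarrow> n \<ge> 1"
| "positive (IM n) \<longleftrightarrow> n \<ge> 1"
| "positive (IY n) \<longleftrightarrow> n \<ge> 0"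

definition sv_pr :: "sv \<Rightarrow> sv" where
  "sv_pr = sv_linear (\<lambda>i. if positive i then sv_basis i else 0)"

lemma sv_pr_simps:
  "sv_pr (x + y) = sv_pr x + sv_pr y"
  "sv_pr (x - y) = sv_pr x - sv_pr y"
  "sv_pr (- x) = - sv_pr x"
  "sv_pr (c *\<^sub>C x) = c *\<^sub>C sv_pr x"
  "sv_pr 0 = 0"
  "sv_pr (sv_basis i) = (if positive i then sv_basis i else 0)"
  by (simp_all add: sv_pr_def sv_linear_simps)

lemma sv_basis_bracket:
  "bracket (sv_basis i) (sv_basis j) = sv_linear sv_basis (Abs_sv (sv_struct i j))"
proof -
  have *: "sv_linear sv_basis x = x" for x
    by (induction x rule: sv_induct) (simp_all add: sv_linear_simps)
  show ?thesis
    unfolding * by (simp add: sv_basis_def bracket_sv.abs_eq eq_onp_same_args sv_bracket_single scaleC_one)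
qed

lemma bracket_basis_simps:
  "sv_linear f (Abs_sv 0) = 0"
  "sv_linear f (Abs_sv (- p)) = - sv_linear f (Abs_sv p)"
  "sv_linear f (Abs_sv (Poly_Mapping.single i c)) = c *\<^sub>C f i"
  by (simp_all add: sv_linear_def Abs_sv_inverse lin_ext_uminus)

lemma bracket_minus:
  "bracket (- x) y = - bracket x y" "bracket x (- y) = - bracket x (y :: 'g::complex_lie_algebra)"
  using bracket_add_left[of x "- x" y] bracket_add_right[of x y "- y"]
  by (simp_all add: eq_neg_iff_add_eq_0 add.commute)

lemma bracket_diff:
  "bracket (x - z) y = bracket x y - bracket z y" "bracket x (y - z) = bracket x y - bracket x (z :: 'g::complex_lie_algebra)"
  by (simp_all only: diff_conv_add_uminus bracket_add_left bracket_add_right bracket_minus)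

lemmas bracket_linear = bracket_add_left bracket_add_right bracket_scale_left bracket_scale_right
  bracket_minus bracket_diff

lemma sv_pr_sv_pr: "sv_pr (sv_pr x) = sv_pr x"
  by (induction x rule: sv_induct) (simp_all add: sv_pr_simps)

lemma sv_pr_bracket:
  assumes "sv_pr x = x" "sv_pr y = y"
  shows "sv_pr (bracket x y) = bracket x y"
proof -
  have "sv_pr (bracket (sv_pr x) (sv_pr y)) = bracket (sv_pr x) (sv_pr y)"
  proof (induction x rule: sv_induct)
    case (basis i)
    show ?case
    proof (induction y rule: sv_induct)
      case (basis j)
      show ?case
        by (cases i; cases j) (auto simp: sv_pr_simps sv_basis_bracket bracket_basis_simps)
    qed (simp_all add: sv_pr_simps bracket_linear)
  qed (simp_all add: sv_pr_simps bracket_linear)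
  then show ?thesis by (simp add: assms)
qed

lemma sv_ker_bilinear_induct:
  assumes add: "\<And>x y z. D (x + y) z = D x z + D y z" "\<And>x y z. D z (x + y) = D z x + D z y"
    and scale: "\<And>c x z. D (c *\<^sub>C x) z = c *\<^sub>C D x z" "\<And>c x z. D z (c *\<^sub>C x) = c *\<^sub>C D z x"
    and basis: "\<And>i j. \<not> positive i \<Longrightarrow> \<not> positive j \<Longrightarrow> D (sv_basis i) (sv_basis j) = (0 :: 'a::complex_vec)"
    and ker: "sv_pr x = 0" "sv_pr y = 0"
  shows "D x y = 0"
proof -
  define neg where "neg x = x - sv_pr x" for x
  have neg: "neg (x + y) = neg x + neg y" "neg (c *\<^sub>C x) = c *\<^sub>C neg x"
    "neg (sv_basis i) = (if positive i then 0 else sv_basis i)" for x y c i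
    by (simp_all add: neg_def sv_pr_simps cvec.scale_right_diff_distrib)
  have zero: "D 0 z = 0" "D z 0 = 0" for z
    using scale(1)[of 0 0 z] scale(2)[of z 0 0] by simp_all
  have "D (neg x) (neg y) = 0"
  proof (induction x rule: sv_induct)
    case (basis i)
    show ?case
      by (induction y rule: sv_induct) (simp_all add: neg add scale zero assms(5))
  qed (simp_all add: neg add scale)
  then show ?thesis by (simp add: neg_def ker)
qed

lemma ker_sv_pr_bracket:
  assumes "sv_pr x = 0" "sv_pr y = 0"
  shows "sv_pr (bracket x y) = 0"
  using _ _ _ _ _ assms
proof (rule sv_ker_bilinear_induct[where D = "\<lambda>x y. sv_pr (bracket x y)"])
  fix i j assume "\<not> positive i" "\<not> positive j"
  then show "sv_pr (bracket (sv_basis i) (sv_basis j)) = 0"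
    by (cases i; cases j) (auto simp: sv_pr_simps sv_basis_bracket bracket_basis_simps)
qed (simp_all add: bracket_linear sv_pr_simps)

lemma sv_pr_in_span: "sv_pr x \<in> cvec.span sv_plus_basis"
proof (induction x rule: sv_induct)
  case (basis i)
  show ?case
    by (cases i) (auto simp: sv_pr_simps sv_plus_basis_def cvec.span_zero intro!: cvec.span_base simp flip: sv_basis_simps)
qed (simp_all add: sv_pr_simps cvec.span_add cvec.span_scale)

lemma sv_pr_of_span:
  assumes "x \<in> cvec.span sv_plus_basis"
  shows "sv_pr x = x"
  using assms
proof (induction rule: cvec.span_induct_alt)
  case base
  show ?case by (simp add: sv_pr_simps)
next
  case (step c x y)
  have "sv_pr x = x"
    using step(1) by (auto simp: sv_plus_basis_def sv_pr_simps simp flip: sv_basis_simps)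
  then show ?case using step(2) by (simp add: sv_pr_simps)
qed

text \<open>
  The two diagonal entries are characters of the complement that differ on $L_0$, and $M_{-1}$ links
  them: $[L_0, M_{-1}] = -M_{-1}$ agrees with $\mathrm{diag}(0,1)\, E_{12} - E_{12}\,
  \mathrm{diag}(0,1) = - E_{12}$. Brackets of complementary basis vectors reach $M_{-1}$ in no other
  way with nonzero coefficient, and they never reach $L_0$ or $M_0$.
\<close>

definition neg_matrix :: "complex \<Rightarrow> sv_index \<Rightarrow> upper_tri" where
  "neg_matrix \<xi> i = (if i = IL 0 then UT 0 0 1 else if i = IM 0 then UT \<xi> 0 \<xi>
    else if i = IM (- 1) then UT 0 1 0 else 0)"

lemma neg_matrix_bracket:
  assumes "sv_pr x = 0" "sv_pr y = 0"
  shows "sv_linear (neg_matrix \<xi>) (bracket x y) = sv_linear (neg_matrix \<xi>) x * sv_linear (neg_matrix \<xi>) y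
    - sv_linear (neg_matrix \<xi>) y * sv_linear (neg_matrix \<xi>) x"
proof -
  let ?R = "sv_linear (neg_matrix \<xi>)"
  have "?R (bracket x y) - (?R x * ?R y - ?R y * ?R x) = 0"
    using _ _ _ _ _ assms
  proof (rule sv_ker_bilinear_induct[where D = "\<lambda>x y. ?R (bracket x y) - (?R x * ?R y - ?R y * ?R x)"])
    fix i j assume "\<not> positive i" "\<not> positive j"
    then show "?R (bracket (sv_basis i) (sv_basis j)) - (?R (sv_basis i) * ?R (sv_basis j)
        - ?R (sv_basis j) * ?R (sv_basis i)) = 0"
      by (cases i; cases j)
        (auto simp: sv_linear_simps sv_basis_bracket bracket_basis_simps neg_matrix_def upper_tri_defs)
  qed (simp_all add: bracket_linear sv_linear_simps distrib_left distrib_right scaleC_mult_left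
      scaleC_mult_right cvec.scale_right_diff_distrib)
  then show ?thesis by simp
qed

lemma neg_matrix_pr: "sv_linear (neg_matrix \<xi>) (sv_pr x) = 0"
proof (induction x rule: sv_induct)
  case (basis i)
  show ?case by (cases i) (auto simp: sv_pr_simps sv_linear_simps neg_matrix_def)
qed (simp_all add: sv_pr_simps sv_linear_simps)

section \<open>The Gauss map of a singular character\<close>

definition sv_proj :: "sv \<Rightarrow> sv_plus" where
  "sv_proj x = Abs_sv_plus (sv_pr x)"

lemma Rep_sv_proj: "Rep_sv_plus (sv_proj x) = sv_pr x"
  by (simp add: sv_proj_def Abs_sv_plus_inverse sv_pr_in_span)

lemma sv_proj_linear: "sv_proj (c *\<^sub>C x + y) = c *\<^sub>C sv_proj x + sv_proj y"
  by (simp add: Rep_sv_plus_inject[symmetric] plus_sv_plus.rep_eq scaleC_sv_plus.rep_eq Rep_sv_proj sv_pr_simps)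

lemma sv_proj_bracket:
  assumes "sv_pr x = x" "sv_pr y = y"
  shows "sv_proj (bracket x y) = bracket (sv_proj x) (sv_proj y)"
  using assms by (simp add: Rep_sv_plus_inject[symmetric] bracket_sv_plus.rep_eq Rep_sv_proj sv_pr_bracket)

locale singular_datum =
  fixes \<psi> :: "sv_plus \<Rightarrow> complex" and \<xi> :: complex
  assumes \<psi>: "lie_hom \<psi>"
    and \<psi>_L: "n \<ge> 3 \<Longrightarrow> \<psi> (Abs_sv_plus (svL n)) = 0"
    and \<psi>_M: "n \<ge> 1 \<Longrightarrow> \<psi> (Abs_sv_plus (svM n)) = 0"
    and \<psi>_Y: "n \<ge> 1 \<Longrightarrow> \<psi> (Abs_sv_plus (svY n)) = 0"
begin

text \<open>\<open>\<psi>\<close> extended by zero on the complement of \<open>sv_plus\<close>.\<close>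

definition char :: "sv \<Rightarrow> complex" where
  "char x = \<psi> (sv_proj x)"

lemma char_linear: "char (c *\<^sub>C x + y) = c * char x + char y"
  using \<psi> unfolding char_def sv_proj_linear by (simp add: lie_hom_def scaleC_complex_def)

lemma char_0: "char 0 = 0"
  using char_linear[of "- 1" 0 0] by simp

lemma char_bracket: "sv_pr x = x \<Longrightarrow> sv_pr y = y \<Longrightarrow> char (bracket x y) = 0"
  using \<psi> by (simp add: char_def sv_proj_bracket lie_hom_def bracket_complex_def)

definition half_rep :: "sv \<Rightarrow> upper_tri" where
  "half_rep x = sv_linear (neg_matrix \<xi>) x + char x *\<^sub>C 1"

lemma half_rep_pr: "sv_pr x = x \<Longrightarrow> half_rep x = char x *\<^sub>C 1"
  using neg_matrix_pr[of \<xi> x] by (simp add: half_rep_def)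

lemma half_rep_ker: "sv_pr x = 0 \<Longrightarrow> half_rep x = sv_linear (neg_matrix \<xi>) x"
  using char_0 by (simp add: half_rep_def char_def sv_proj_def sv_pr_simps)

sublocale split_representation sv_pr half_rep
proof
  fix x y :: sv and c a
  show "half_rep (c *\<^sub>C x + y) = c *\<^sub>C half_rep x + half_rep y"
    by (simp add: half_rep_def sv_linear_simps char_linear scaleC_add_left scaleC_add_right scaleC_scaleC)
  show "half_rep x * a = a * half_rep x" if "sv_pr x = x"
    using that by (simp add: half_rep_pr scaleC_mult_left scaleC_mult_right)
  show "half_rep (bracket x y) = 0" if "sv_pr x = x" "sv_pr y = y"
    using that by (simp add: half_rep_pr sv_pr_bracket char_bracket)
  show "half_rep (bracket x y) = half_rep x * half_rep y - half_rep y * half_rep x"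
    if "sv_pr x = 0" "sv_pr y = 0"
    using that by (simp add: half_rep_ker ker_sv_pr_bracket neg_matrix_bracket)
qed (simp_all add: sv_pr_simps sv_pr_sv_pr sv_pr_bracket ker_sv_pr_bracket)

lemma gauss_mult_char: "sv_pr x = x \<Longrightarrow> gauss (u * uea_incl x) = char x *\<^sub>C gauss u"
  by (simp add: gauss_mult_pr half_rep_pr scaleC_mult_right)

lemma char_vanish:
  "n \<ge> 3 \<Longrightarrow> char (svL n) = 0" "n \<ge> 1 \<Longrightarrow> char (svM n) = 0" "n \<ge> 1 \<Longrightarrow> char (svY n) = 0"
  using \<psi>_L[of n] \<psi>_M[of n] \<psi>_Y[of n]
  by (simp_all add: char_def sv_proj_def sv_pr_simps flip: sv_basis_simps)

lemma gauss_mult_basis: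
  "n \<ge> 1 \<Longrightarrow> gauss (u * uea_incl (svL n)) = char (svL n) *\<^sub>C gauss u"
  "n \<ge> 1 \<Longrightarrow> gauss (u * uea_incl (svM n)) = 0"
  "n \<ge> 0 \<Longrightarrow> gauss (u * uea_incl (svY n)) = char (svY n) *\<^sub>C gauss u"
  using gauss_mult_char[of "svL n" u] gauss_mult_char[of "svM n" u] gauss_mult_char[of "svY n" u]
  by (simp_all add: char_vanish) (simp_all add: sv_pr_simps flip: sv_basis_simps)

lemma svM_0_mult_gauss: "gauss (uea_incl (svM 0) * u) = \<xi> *\<^sub>C gauss u"
proof -
  have "sv_pr (svM 0) = 0" by (simp add: sv_pr_simps flip: sv_basis_simps)
  then show ?thesis
    by (simp add: gauss_ker_mult half_rep_ker)
      (simp add: sv_linear_simps neg_matrix_def upper_tri_defs flip: sv_basis_simps)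
qed

text \<open>
  $M_0$ lies in the complement, so equivariance only gives its action from the left; it can be applied
  on the right as well since $M_0$ is central.
\<close>

lemma gauss_mult_svM_0: "gauss (u * uea_incl (svM 0)) = \<xi> *\<^sub>C gauss u"
proof -
  have "uea_incl (svM 0) * prod_list (map uea_incl w) = prod_list (map uea_incl w) * uea_incl (svM 0)" for w
  proof (induction w)
    case (Cons x w)
    have "uea_incl (svM 0) * uea_incl x = uea_incl x * uea_incl (svM 0)"
      using uea_incl_simps(3)[of "svM 0" x] uea_incl_simps(2)[of 0 "0::sv"] by (simp add: svM_0_central)
    then have "uea_incl (svM 0) * (uea_incl x * prod_list (map uea_incl w))
        = uea_incl x * (uea_incl (svM 0) * prod_list (map uea_incl w))"
      by (simp flip: mult.assoc)
    then show ?case by (simp add: Cons.IH mult.assoc)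
  qed simp
  then have "uea_incl (svM 0) * u = u * uea_incl (svM 0)"
    by (induction u rule: uea_word_induct) (simp_all add: distrib_left distrib_right scaleC_mult_left scaleC_mult_right)
  then show ?thesis using svM_0_mult_gauss[of u] by simp
qed

section \<open>Whittaker vectors\<close>

text \<open>
  Modulo the left ideal of all \<open>t\<close> with \<open>gauss (u * t) = 0\<close> for every \<open>u\<close>, the product \<open>v * x\<close> with a
  positive \<open>x\<close> equals \<open>\<psi> x\<close> times \<open>v\<close>. The vanishing of the commutator therefore says that
  \<open>x\<close> acts on the class of \<open>v\<close> by the scalar \<open>\<psi> x\<close>.
\<close>

definition whittaker :: "sv uea \<Rightarrow> bool" where
  "whittaker v \<longleftrightarrow> (\<forall>i u. positive i \<longrightarrow>
    gauss (u * (uea_incl (sv_basis i) * v - v * uea_incl (sv_basis i))) = 0)"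

text \<open>
  For a Whittaker vector \<open>v\<close> the map \<open>\<lambda>u. gauss (u * v)\<close> has the equivariance of \<open>gauss\<close>, so uniqueness
  applies.
\<close>

lemma gauss_mult_whittaker:
  assumes "whittaker v"
  shows "gauss (u * v) = gauss u * gauss v"
proof -
  define D where "D x u = gauss (u * (uea_incl x * v - v * uea_incl x))" for x u
  have D_linear: "D (x + y) u = D x u + D y u" "D (c *\<^sub>C x) u = c *\<^sub>C D x u" for x y c u
    by (simp_all add: D_def uea_incl_simps algebra_simps gauss_add gauss_diff gauss_scale
        scaleC_mult_left scaleC_mult_right cvec.scale_right_diff_distrib)
  have D_zero: "D 0 u = 0" for u
    using D_linear(2)[of 0 0 u] by simp
  have D: "D (sv_pr x) u = 0" for x u
  proof (induction x rule: sv_induct)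
    case (basis i)
    show ?case
      using assms by (simp add: sv_pr_simps D_zero) (simp add: D_def whittaker_def)
  qed (simp_all add: sv_pr_simps D_linear)
  have "gauss (u * v) = gauss u * gauss (1 * v)"
  proof (rule gauss_unique[where H = "\<lambda>u. gauss (u * v)"])
    fix x u assume x: "sv_pr x = x"
    have "gauss (u * uea_incl x * v) = gauss (u * v * uea_incl x)"
      using D[of x u] by (simp add: x D_def right_diff_distrib gauss_diff mult.assoc)
    then show "gauss (u * uea_incl x * v) = gauss (u * v) * half_rep x"
      by (simp add: gauss_mult_pr x)
  qed (simp_all add: gauss_add gauss_scale distrib_right scaleC_mult_left mult.assoc gauss_ker_mult)
  then show ?thesis by simp
qed

text \<open>
  The commutators $[L_n, M_{-1}] = -M_{n-1}$ act on the generator by \<open>\<psi>\<close>, which vanishes on every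
  positive $M_k$ by singularity, or by $M_0$, that is by \<open>\<xi>\<close>.
\<close>

lemma whittaker_svM:
  assumes "\<xi> = 0"
  shows "whittaker (uea_incl (svM (- 1)))"
  unfolding whittaker_def
proof (intro allI impI)
  fix i u assume "positive i"
  then have "gauss (u * uea_incl (bracket (sv_basis i) (svM (- 1)))) = 0"
  proof (cases i)
    case (IL n)
    have "gauss (u * uea_incl (svM (n - 1))) = 0"
      using \<open>positive i\<close> gauss_mult_basis(2)[of "n - 1" u] gauss_mult_svM_0[of u]
      by (cases "n = 1") (simp_all add: IL assms)
    then show ?thesis
      by (simp add: IL sv_basis_simps sv_brackets uea_incl_simps(2) uea_incl_minus gauss_minus scaleC_mult_right gauss_scale)
  qed (simp_all add: sv_basis_simps sv_brackets bracket_antisym[of "svY _" "svM _"] uea_incl_zero gauss_zero)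
  then show "gauss (u * (uea_incl (sv_basis i) * uea_incl (svM (- 1))
      - uea_incl (svM (- 1)) * uea_incl (sv_basis i))) = 0"
    by (simp add: uea_incl_simps(3))
qed

text \<open>
  Let $v = L_0 + \alpha Y_{-1/2} + \beta M_{-1} + \gamma M_{-2} + \delta M_{-1}^2$, and let $a$, $b$, $c$
  be the values of \<open>\<psi>\<close> at $L_1$, $L_2$, $Y_{1/2}$. On the generator $w$ the commutators of $v$ with
  positive basis vectors act as follows: $Y_{1/2}$ gives $-\frac{c}{2} - \alpha\xi$, $L_2$ gives
  $-2b - 2\gamma\xi$, $L_1$ gives $(-a - \alpha c - \beta\xi) - 2(\gamma + \delta\xi) M_{-1}$, and
  the others give $0$. The coefficients below solve the resulting equations. The quadratic term is
  there to cancel the multiple of $M_{-1} w$ that $M_{-2}$ produces.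
\<close>

definition singular_vector :: "sv uea" where
  "singular_vector = (
    let a = char (svL 1); b = char (svL 2); c = char (svY 0); \<alpha> = - c / (2 * \<xi>) in
    uea_incl (svL 0) + \<alpha> *\<^sub>C uea_incl (svY (- 1)) + (- (a + \<alpha> * c) / \<xi>) *\<^sub>C uea_incl (svM (- 1))
    + (- b / \<xi>) *\<^sub>C uea_incl (svM (- 2)) + (b / \<xi>\<^sup>2) *\<^sub>C (uea_incl (svM (- 1)) * uea_incl (svM (- 1))))"

lemma whittaker_singular_vector:
  assumes \<xi>: "\<xi> \<noteq> 0"
  shows "whittaker singular_vector"
  unfolding whittaker_def
proof (intro allI impI)
  fix i u assume i: "positive i"
  define a b c \<alpha> \<beta> \<gamma> \<delta> where coeff_defs: "a = char (svL 1)" "b = char (svL 2)" "c = char (svY 0)"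
    "\<alpha> = - c / (2 * \<xi>)" "\<beta> = - (a + \<alpha> * c) / \<xi>" "\<gamma> = - b / \<xi>" "\<delta> = b / \<xi>\<^sup>2"
  let ?I = "uea_incl :: sv \<Rightarrow> sv uea" and ?x = "sv_basis i"
  have v: "singular_vector = ?I (svL 0) + \<alpha> *\<^sub>C ?I (svY (- 1)) + \<beta> *\<^sub>C ?I (svM (- 1))
      + \<gamma> *\<^sub>C ?I (svM (- 2)) + \<delta> *\<^sub>C (?I (svM (- 1)) * ?I (svM (- 1)))"
    by (simp add: singular_vector_def coeff_defs Let_def)
  have swap: "?I ?x * ?I y = ?I y * ?I ?x + ?I (bracket ?x y)" for y
    by (simp add: uea_incl_simps(3))
  \<comment> \<open>All brackets with $M_{-1}$ are multiples of some $M_k$, and these commute.\<close>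
  have "bracket (bracket ?x (svM (- 1))) (svM (- 1)) = 0"
    by (cases i) (simp_all add: sv_basis_simps sv_brackets bracket_minus bracket_antisym[of "svY _" "svM _"])
  then have "?I (bracket ?x (svM (- 1))) * ?I (svM (- 1)) = ?I (svM (- 1)) * ?I (bracket ?x (svM (- 1)))"
    using uea_incl_simps(3)[of "bracket ?x (svM (- 1))" "svM (- 1)"] by (simp add: uea_incl_zero)
  then have square: "?I ?x * (?I (svM (- 1)) * ?I (svM (- 1))) = ?I (svM (- 1)) * ?I (svM (- 1)) * ?I ?x
      + 2 *\<^sub>C (?I (svM (- 1)) * ?I (bracket ?x (svM (- 1))))"
    using scaleC_add_left[of 1 1 "?I (svM (- 1)) * ?I (bracket ?x (svM (- 1)))"]
    by (simp add: mult.assoc[symmetric] swap distrib_right) (simp add: mult.assoc swap distrib_left scaleC_one)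
  have "?I ?x * singular_vector - singular_vector * ?I ?x
      = ?I (bracket ?x (svL 0)) + \<alpha> *\<^sub>C ?I (bracket ?x (svY (- 1))) + \<beta> *\<^sub>C ?I (bracket ?x (svM (- 1)))
      + \<gamma> *\<^sub>C ?I (bracket ?x (svM (- 2))) + (2 * \<delta>) *\<^sub>C (?I (svM (- 1)) * ?I (bracket ?x (svM (- 1))))"
    by (simp add: v distrib_left distrib_right scaleC_mult_left scaleC_mult_right swap square
        scaleC_add_right scaleC_scaleC mult.commute[of \<delta>])
  then have "gauss (u * (?I ?x * singular_vector - singular_vector * ?I ?x))
      = gauss (u * ?I (bracket ?x (svL 0))) + \<alpha> *\<^sub>C gauss (u * ?I (bracket ?x (svY (- 1))))
      + \<beta> *\<^sub>C gauss (u * ?I (bracket ?x (svM (- 1)))) + \<gamma> *\<^sub>C gauss (u * ?I (bracket ?x (svM (- 2))))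
      + (2 * \<delta>) *\<^sub>C gauss (u * ?I (svM (- 1)) * ?I (bracket ?x (svM (- 1))))"
    by (simp add: distrib_left scaleC_mult_right gauss_add gauss_scale mult.assoc)
  also have "\<dots> = 0"
  proof (cases i)
    case (IL n)
    then have n: "n \<ge> 1" using i by simp
    consider "n = 1" | "n = 2" | "n \<ge> 3" using n by linarith
    then show ?thesis
    proof cases
      case 1
      show ?thesis
        by (simp add: IL 1 sv_basis_simps sv_brackets uea_incl_simps(2) uea_incl_minus gauss_minus scaleC_mult_right gauss_scale
          gauss_mult_basis gauss_mult_svM_0 scaleC_scaleC flip: coeff_defs(1-3))
          (simp add: coeff_defs \<xi> power2_eq_square cvec.scale_left_diff_distrib)
    next
      case 2
      show ?thesis
        by (simp add: IL 2 sv_basis_simps sv_brackets uea_incl_simps(2) uea_incl_minus gauss_minus scaleC_mult_right gauss_scale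
          gauss_mult_basis gauss_mult_svM_0 scaleC_scaleC char_vanish flip: coeff_defs(1-3))
          (simp add: coeff_defs \<xi> power2_eq_square cvec.scale_left_diff_distrib)
    next
      case 3
      then show ?thesis
        by (simp add: IL sv_basis_simps sv_brackets uea_incl_simps(2) uea_incl_minus gauss_minus scaleC_mult_right gauss_scale
          gauss_mult_basis char_vanish)
    qed
  next
    case (IM n)
    then show ?thesis
      using i by (simp add: sv_basis_simps sv_brackets bracket_antisym[of "svM _" "svL _"] uea_incl_minus uea_incl_zero
          uea_incl_simps(2) scaleC_mult_right gauss_scale gauss_mult_basis gauss_zero gauss_minus)
  next
    case (IY n)
    then have n: "n \<ge> 0" using i by simp
    then consider "n = 0" | "n \<ge> 1" by linarith
    then show ?thesis
    proof cases
      case 1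
      show ?thesis
        by (simp add: IY 1 sv_basis_simps sv_brackets bracket_antisym[of "svY _" "svL _"] bracket_antisym[of "svY _" "svM _"]
          uea_incl_minus uea_incl_zero gauss_zero gauss_minus uea_incl_simps(2) scaleC_mult_right gauss_scale
          gauss_mult_basis gauss_mult_svM_0 scaleC_scaleC flip: coeff_defs(1-3))
          (simp add: coeff_defs \<xi> power2_eq_square cvec.scale_left_diff_distrib)
    next
      case 2
      then show ?thesis
        by (simp add: IY sv_basis_simps sv_brackets bracket_antisym[of "svY _" "svL _"] bracket_antisym[of "svY _" "svM _"]
          uea_incl_minus uea_incl_zero gauss_zero gauss_minus uea_incl_simps(2) scaleC_mult_right gauss_scale
          gauss_mult_basis char_vanish)
    qed
  qed
  finally show "gauss (u * (?I ?x * singular_vector - singular_vector * ?I ?x)) = 0" .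
qed

text \<open>
  When \<open>\<xi> = 0\<close> the image of the Whittaker vector $M_{-1}$ is $E_{12}$. Otherwise the image of
  \<open>singular_vector\<close> is the image $\mathrm{diag}(0,1)$ of $L_0$ up to a multiple of $E_{12}$.
\<close>

lemma whittaker_vector_exists:
  obtains v where "whittaker v" "ent11 (gauss v) = 0" "gauss v \<noteq> 0"
proof (cases "\<xi> = 0")
  case True
  have "gauss (uea_incl (svM (- 1))) = half_rep (svM (- 1))"
    using gauss_words[of "[svM (- 1)]"] gauss_word_ker[of "svM (- 1)" "[]"]
    by (simp add: sv_pr_simps flip: sv_basis_simps)
  also have "\<dots> = UT 0 1 0"
    by (subst half_rep_ker)
      (simp_all add: sv_pr_simps sv_linear_simps neg_matrix_def flip: sv_basis_simps)
  finally show ?thesis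
    using that[OF whittaker_svM[OF True]] by (simp add: zero_upper_tri_def)
next
  case False
  have ker: "sv_pr (svL 0) = 0" "sv_pr (svY (- 1)) = 0" "sv_pr (svM (- 1)) = 0" "sv_pr (svM (- 2)) = 0"
    by (simp_all add: sv_pr_simps flip: sv_basis_simps)
  have rep: "half_rep (svL 0) = UT 0 0 1" "half_rep (svY (- 1)) = 0" "half_rep (svM (- 1)) = UT 0 1 0"
    "half_rep (svM (- 2)) = 0"
    unfolding half_rep_ker[OF ker(1)] half_rep_ker[OF ker(2)] half_rep_ker[OF ker(3)] half_rep_ker[OF ker(4)]
    by (simp_all add: sv_linear_simps neg_matrix_def flip: sv_basis_simps)
  have incl: "gauss (uea_incl x) = half_rep x" if "sv_pr x = 0" for x
    using gauss_ker_mult[OF that, of 1] by (simp add: gauss_one)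
  have "ent11 (gauss singular_vector) = 0" "ent22 (gauss singular_vector) = 1"
    by (simp_all add: singular_vector_def Let_def gauss_add gauss_diff gauss_scale gauss_ker_mult ker incl rep upper_tri_defs)
  moreover from this have "gauss singular_vector \<noteq> 0"
    using upper_tri.sel(3)[of 0 0 0] by (metis zero_neq_one zero_upper_tri_def)
  ultimately show ?thesis
    using that[OF whittaker_singular_vector[OF False]] by blast
qed

section \<open>The submodule\<close>

lemma gauss_balanced:
  "gauss (u * uea_lift (\<lambda>x. uea_incl (Rep_sv_plus x)) a) = uea_lift \<psi> a *\<^sub>C gauss u"
proof (induction a arbitrary: u rule: uea_word_induct)
  case (word w)
  note lift = uea_lift[OF lie_rep_sv_plus] uea_lift[OF lie_hom_imp_lie_rep[OF \<psi>]]
  show ?case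
  proof (induction w arbitrary: u)
    case Nil
    show ?case by (simp add: lift scaleC_one)
  next
    case (Cons x w)
    have "sv_pr (Rep_sv_plus x) = Rep_sv_plus x"
      by (rule sv_pr_of_span) (rule Rep_sv_plus)
    moreover from this have "char (Rep_sv_plus x) = \<psi> x"
      by (simp add: char_def sv_proj_def Rep_sv_plus_inverse)
    ultimately show ?case
      using Cons.IH[of "u * uea_incl (Rep_sv_plus x)"]
      by (simp add: lift gauss_mult_char scaleC_scaleC mult.assoc mult.commute[of "\<psi> x"])
  qed
qed (simp_all add: uea_lift[OF lie_rep_sv_plus] uea_lift[OF lie_hom_imp_lie_rep[OF \<psi>]]
    distrib_left scaleC_mult_right gauss_add gauss_scale scaleC_add_left scaleC_scaleC scaleC_complex_def)

text \<open>
  The canonical map from representatives of tensors to the enveloping algebra. It does not respect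
  \<open>tensor_rel\<close>, but its composition with \<open>gauss\<close> does.
\<close>

definition collapse :: "(sv uea \<times> complex \<Rightarrow>\<^sub>0 complex) \<Rightarrow> sv uea" where
  "collapse = lin_ext (\<lambda>(u, \<alpha>). \<alpha> *\<^sub>C u)"

lemma collapse_simps:
  "collapse (p + q) = collapse p + collapse q"
  "collapse (p - q) = collapse p - collapse q"
  "collapse (c *\<^sub>C p) = c *\<^sub>C collapse p"
  "collapse 0 = 0"
  "collapse (pure_tensor u \<alpha>) = \<alpha> *\<^sub>C u"
  by (simp_all add: collapse_def lin_ext_add lin_ext_diff lin_ext_scale pure_tensor_def scaleC_one)

lemma collapse_act: "collapse (act sv_tensor_free x p) = uea_incl x * collapse p"
proof (induction p rule: free_induct)
  case (single b)
  obtain u \<alpha> where "b = (u, \<alpha>)" by (cases b)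
  then have "Poly_Mapping.single b 1 = pure_tensor u \<alpha>" by (simp add: pure_tensor_def)
  then show ?case
    by (simp add: sv_tensor_free_act_pure collapse_simps scaleC_mult_right)
qed (simp_all add: sv_tensor_free_act_linear collapse_simps distrib_left scaleC_mult_right)

lemma gauss_collapse_rel:
  assumes "p \<in> tensor_rel right_act (psi_act \<psi>)"
  shows "gauss (collapse p) = 0"
  using assms unfolding tensor_rel_def
proof (induction rule: cvec.span_induct_alt)
  case (step c x y)
  have "gauss (collapse x) = 0"
    using step(1) by (auto simp: collapse_simps scaleC_add_right scaleC_add_left scaleC_scaleC gauss_add
        gauss_diff gauss_scale gauss_zero right_act_def psi_act_def gauss_balanced scaleC_complex_def mult.commute)
  then show ?case using step(2) by (simp add: collapse_simps gauss_add gauss_scale)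
qed (simp add: collapse_simps gauss_zero)

text \<open>
  Elements of both quotients are handled through representatives in the free vector space on pairs.
\<close>

definition class_W :: "(sv uea \<times> complex \<Rightarrow>\<^sub>0 complex) \<Rightarrow> _" where
  "class_W p = coset sv_tensor_free (tensor_rel right_act (psi_act \<psi>)) p"

definition class_L :: "(sv uea \<times> complex \<Rightarrow>\<^sub>0 complex) \<Rightarrow> _" where
  "class_L p = coset (W_mod \<psi>) (M0_shift_image \<psi> \<xi>) (class_W p)"

lemma class_W_simps:
  "carrier (W_mod \<psi>) = range class_W"
  "vzero (W_mod \<psi>) = class_W 0"
  "vadd (W_mod \<psi>) (class_W p) (class_W q) = class_W (p + q)"
  "vscale (W_mod \<psi>) c (class_W p) = class_W (c *\<^sub>C p)"
  "act (W_mod \<psi>) x (class_W p) = class_W (act sv_tensor_free x p)"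
proof -
  interpret F: action_space sv_tensor_free by (rule action_space_sv_tensor_free)
  have ops: "carrier sv_tensor_free = UNIV" "vzero sv_tensor_free = 0" "vadd sv_tensor_free = (+)"
    "vscale sv_tensor_free = scaleC"
    by (simp_all add: sv_tensor_free_def)
  note q = F.quotient_simps[OF submodule_tensor_rel] F.quotient_carrier[OF submodule_tensor_rel]
  show "carrier (W_mod \<psi>) = range class_W"
    by (auto simp: W_mod_def class_W_def q ops)
  show "vzero (W_mod \<psi>) = class_W 0"
    "vadd (W_mod \<psi>) (class_W p) (class_W q) = class_W (p + q)"
    "vscale (W_mod \<psi>) c (class_W p) = class_W (c *\<^sub>C p)"
    "act (W_mod \<psi>) x (class_W p) = class_W (act sv_tensor_free x p)"
    by (simp_all add: W_mod_def class_W_def q ops)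
qed

lemma class_L_simps:
  "carrier (L_mod \<psi> \<xi>) = range class_L"
  "vzero (L_mod \<psi> \<xi>) = class_L 0"
  "vadd (L_mod \<psi> \<xi>) (class_L p) (class_L q) = class_L (p + q)"
  "vscale (L_mod \<psi> \<xi>) c (class_L p) = class_L (c *\<^sub>C p)"
  "act (L_mod \<psi> \<xi>) x (class_L p) = class_L (act sv_tensor_free x p)"
proof -
  interpret W: lie_module "W_mod \<psi>" by (rule lie_module_W_mod)
  note q = W.quotient_simps[OF submodule_M0_shift_image] W.quotient_carrier[OF submodule_M0_shift_image]
  show "carrier (L_mod \<psi> \<xi>) = range class_L"
    by (auto simp: L_mod_def class_L_def q class_W_simps)
  show "vzero (L_mod \<psi> \<xi>) = class_L 0"
    "vadd (L_mod \<psi> \<xi>) (class_L p) (class_L q) = class_L (p + q)"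
    "vscale (L_mod \<psi> \<xi>) c (class_L p) = class_L (c *\<^sub>C p)"
    "act (L_mod \<psi> \<xi>) x (class_L p) = class_L (act sv_tensor_free x p)"
    by (simp_all add: L_mod_def class_L_def q class_W_simps)
qed

lemma gauss_class_L:
  assumes "class_L p = class_L q"
  shows "gauss (collapse p) = gauss (collapse q)"
proof -
  interpret F: action_space sv_tensor_free by (rule action_space_sv_tensor_free)
  interpret W: lie_module "W_mod \<psi>" by (rule lie_module_W_mod)
  have "class_W p \<in> class_L p"
    unfolding class_L_def by (rule W.coset_self[OF submodule_M0_shift_image]) (simp add: class_W_simps)
  then have "class_W p \<in> class_L q"
    by (simp only: assms)
  \<comment> \<open>Equal classes in the outer quotient differ by an element of $(M_0 - \xi)W_\psi$.\<close>
  then obtain r where "class_W p = class_W (q + (act sv_tensor_free (svM 0) r + (- \<xi>) *\<^sub>C r))"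
    by (auto simp: class_L_def coset_def M0_shift_image_def class_W_simps)
  moreover have "p \<in> class_W p"
    unfolding class_W_def by (rule F.coset_self[OF submodule_tensor_rel]) (simp add: sv_tensor_free_def)
  ultimately obtain t where "t \<in> tensor_rel right_act (psi_act \<psi>)"
    and "p = q + (act sv_tensor_free (svM 0) r + (- \<xi>) *\<^sub>C r) + t"
    by (auto simp: class_W_def coset_def sv_tensor_free_def)
  then show ?thesis
    by (simp add: collapse_simps collapse_act gauss_add gauss_diff gauss_minus gauss_scale svM_0_mult_gauss gauss_collapse_rel)
qed

text \<open>
  The representatives in \<open>K\<close> are those that the upper left entry of \<open>gauss\<close> cannot detect, even after
  acting by the enveloping algebra. This entry is multiplicative on upper triangular matrices, which
  puts the Whittaker vector into \<open>K\<close>, while the other entries show that its class is nonzero.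
\<close>

lemma reducible_L_mod: "reducible (L_mod \<psi> \<xi>)"
proof -
  define K where "K = {p. \<forall>u. ent11 (gauss (u * collapse p)) = 0}"
  obtain v where v: "whittaker v" "ent11 (gauss v) = 0" "gauss v \<noteq> 0"
    by (rule whittaker_vector_exists)
  have sub: "submodule (class_L ` K) (L_mod \<psi> \<xi>)"
    unfolding submodule_def
  proof (intro conjI allI ballI)
    show "class_L ` K \<subseteq> carrier (L_mod \<psi> \<xi>)"
      by (auto simp: class_L_simps)
    have "0 \<in> K" by (simp add: K_def collapse_simps gauss_zero upper_tri_defs)
    then show "vzero (L_mod \<psi> \<xi>) \<in> class_L ` K" by (auto simp: class_L_simps)
  next
    fix s t assume "s \<in> class_L ` K" "t \<in> class_L ` K"
    then obtain p q where "p \<in> K" "q \<in> K" "s = class_L p" "t = class_L q" by auto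
    moreover from this have "p + q \<in> K"
      by (simp add: K_def collapse_simps distrib_left gauss_add) (simp add: plus_upper_tri_def)
    ultimately show "vadd (L_mod \<psi> \<xi>) s t \<in> class_L ` K" by (auto simp: class_L_simps)
  next
    fix c s assume "s \<in> class_L ` K"
    then obtain p where "p \<in> K" "s = class_L p" by auto
    moreover from this have "c *\<^sub>C p \<in> K"
      by (simp add: K_def collapse_simps scaleC_mult_right gauss_scale) (simp add: scaleC_upper_tri_def)
    ultimately show "vscale (L_mod \<psi> \<xi>) c s \<in> class_L ` K" by (auto simp: class_L_simps)
  next
    fix x s assume "s \<in> class_L ` K"
    then obtain p where "p \<in> K" "s = class_L p" by auto
    moreover from this have "act sv_tensor_free x p \<in> K"
      by (simp add: K_def collapse_act flip: mult.assoc)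
    ultimately show "act (L_mod \<psi> \<xi>) x s \<in> class_L ` K" by (auto simp: class_L_simps)
  qed
  have "pure_tensor v 1 \<in> K"
    using v(2) by (simp add: K_def collapse_simps scaleC_one gauss_mult_whittaker[OF v(1)] times_upper_tri_def)
  moreover have "class_L (pure_tensor v 1) \<noteq> class_L 0"
    using gauss_class_L[of "pure_tensor v 1" 0] v(3) by (auto simp: collapse_simps scaleC_one gauss_zero)
  ultimately have nonzero: "class_L ` K \<noteq> {vzero (L_mod \<psi> \<xi>)}"
    unfolding class_L_simps by blast
  have "class_L (pure_tensor 1 1) \<notin> class_L ` K"
  proof
    assume "class_L (pure_tensor 1 1) \<in> class_L ` K"
    then obtain p where "p \<in> K" and eq: "class_L (pure_tensor 1 1) = class_L p" by auto
    then have "ent11 (gauss (1 * collapse p)) = 0" by (simp only: K_def mem_Collect_eq)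
    then show False
      using gauss_class_L[OF eq] by (simp add: collapse_simps scaleC_one gauss_one one_upper_tri_def)
        (metis upper_tri.sel(1) zero_neq_one)
  qed
  then have "class_L ` K \<noteq> carrier (L_mod \<psi> \<xi>)"
    unfolding class_L_simps by blast
  with sub nonzero show ?thesis
    unfolding reducible_def by blast
qed

end

theorem theorem5p3:
  fixes \<psi> :: "sv_plus \<Rightarrow> complex" and \<xi> :: complex
  assumes "lie_hom \<psi>"
    and "\<And>n. n \<ge> 3 \<Longrightarrow> \<psi> (Abs_sv_plus (svL n)) = 0"
    and "\<And>m. m \<ge> 2 \<Longrightarrow> \<psi> (Abs_sv_plus (svM m)) = 0"
    and "\<And>k. k \<ge> 1 \<Longrightarrow> \<psi> (Abs_sv_plus (svY k)) = 0"
    and singular: "\<psi> (Abs_sv_plus (svM 1)) = 0"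
  shows "reducible (L_mod \<psi> \<xi>)"
proof -
  have "\<psi> (Abs_sv_plus (svM n)) = 0" if "n \<ge> 1" for n
    using assms(3)[of n] singular that by (cases "n = 1") simp_all
  then interpret singular_datum \<psi> \<xi>
    using assms by unfold_locales
  show ?thesis by (rule reducible_L_mod)
qed

end
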